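(* Let $U:\mathbb{C}\to\mathbb{D}$ be a left exact functor between finitely complete pointed categories, with semi-direct index $\rho$. Then $U$ can be factorized through the forgetful functor $\Sigma_{\mathbb{D}}:\Sigma\mathrm{lom}\,\mathbb{D}\to\mathbb{D}$ by a functor $\bar U:\mathbb{C}\to\Sigma\mathrm{lom}\,\mathbb{D}$ (that is, $U=\Sigma_{\mathbb{D}}\circ\bar U$) in such a way that $\rho=\rho^{\Sigma}.\bar U$, i.e. $\rho_{(f,s)}=\rho^{\Sigma}_{(\bar U(f),\bar U(s))}$ for every split epimorphism $(f,s)$ in $\mathbb{C}$. When $\rho$ is moreover a semi-direct hyperindex, $U$ can be factorized through the forgetful functor $H_{\mathbb{D}}:\mathrm{HSt}\,\mathbb{D}\to\mathbb{D}$ by a functor $\bar U:\mathbb{C}\to\mathrm{HSt}\,\mathbb{D}$ in such a way that $\rho=\rho^{HS}.\bar U$, i.e. $\rho_{(f,s)}=\rho^{HS}_{(\bar U(f),\bar U(s))}$ for every split epimorphism $(f,s)$ in $\mathbb{C}$.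
   Context: Left exact means preserving finite limits. A pointed category has a zero object, written $1$. Identities between operations on an object of a category are understood for generalized elements. For a category $\mathbb{E}$, $\mathrm{Pt}\,\mathbb{E}$ is the category whose objects are the split epimorphisms $(f,s):X\rightleftarrows Y$ in $\mathbb{E}$ (so $f s=\mathrm{Id}_Y$), and whose morphisms are the pairs of maps commuting with both the epimorphisms and their sections. Let $U:\mathbb{C}\to\mathbb{D}$ be a left exact functor between finitely complete pointed categories. $\mathrm{Pt}_U:\mathrm{Pt}\,\mathbb{C}\to\mathrm{Pt}\,\mathbb{D}$ is its natural extension. $W_U:\mathrm{Pt}\,\mathbb{C}\to\mathrm{Pt}\,\mathbb{D}$ sends $(f,s):X\rightleftarrows Y$ to $(p_{U(Y)},\iota_{U(Y)}):U(Y)\times U(\mathrm{Ker} f)\rightleftarrows U(Y)$, where $p_{U(Y)}$ is the projection and $\iota_{U(Y)}=(\mathrm{Id}_{U(Y)},0)$; on morphisms it is induced by the action on codomains and on kernels. Write $k_f:\mathrm{Ker} f\to X$ for the kernel map. A semi-direct index for $U$ is a natural isomorphism $\rho:\mathrm{Pt}_U\Rightarrow W_U$ whose component at each $(f,s):X\rightleftarrows Y$ is given by an isomorphism $\rho_{(f,s)}:U(X)\to U(Y)\times U(\mathrm{Ker} f)$ together with the identity on $U(Y)$, so $p_{U(Y)}\rho_{(f,s)}=U(f)$ and $\rho_{(f,s)}U(s)=\iota_{U(Y)}$. Write $\gamma_{(f,s)}:U(X)\to U(\mathrm{Ker} f)$ for its second component, so $\rho_{(f,s)}=(U(f),\gamma_{(f,s)})$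 and $\gamma_{(f,s)}U(s)=0$. A semi-direct hyperindex is a semi-direct index such that in addition $\gamma_{(f,s)}U(k_f)=\mathrm{Id}_{U(\mathrm{Ker} f)}$ for every $(f,s)$. An internal hyper-S\l omi\'nski setting in $\mathbb{D}$ is a quadruple $(X,d,\circ,1)$ of an object $X$, two binary operations $d,\circ:X\times X\to X$ and a point $1\to X$ such that $d(x\circ z,x)=z$, $x\circ d(z,x)=z$ and $d(x,x)=1$. (Equivalently: $(p_1^X,d):X\times X\to X\times X$ is an isomorphism, with $p_1^X$ the second projection, and $d(x,x)=1$; then $\circ$ is determined by $d$.) An internal hypersubtraction is a hyper-S\l omi\'nski setting such that moreover $d(x,1)=x$. $\Sigma\mathrm{lom}\,\mathbb{D}$ and $\mathrm{HSt}\,\mathbb{D}$ denote the categories of internal hyper-S\l omi\'nski settings and internal hypersubtractions in $\mathbb{D}$, with morphisms the maps preserving the operations; in the pointed category $\mathbb{D}$ the constant is the zero map. The forgetful functor $\Sigma_{\mathbb{D}}:\Sigma\mathrm{lom}\,\mathbb{D}\to\mathbb{D}$ has a canonical semi-direct index $\rho^{\Sigma}$: for a split epimorphism $(f,s):X\rightleftarrows Y$ in $\Sigma\mathrm{lom}\,\mathbb{D}$, $\rho^{\Sigma}_{(f,s)}=(f,\gamma^{\Sigma}_{(f,s)})$ with $\gamma^{\Sigma}_{(f,s)}(x)=d(x,sf(x))\in\mathrm{Ker} f$, with inverse $(y,k)\mapsto s(y)\circ k$. The same formula gives the canonical semi-direct hyperindex $\rho^{HS}$ for the forgetful functor $H_{\mathbb{D}}:\mathrm{HSt}\,\mathbb{D}\to\mathbb{D}$.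 *)

theory Defs
  imports Main
begin

text \<open>Composition is only meaningful on composable arrows; functors are only meaningful
  on the objects and arrows of their domain category.\<close>

record ('o, 'a) category =
  Obj :: "'o set"
  Arr :: "'a set"
  Dom :: "'a \<Rightarrow> 'o"
  Cod :: "'a \<Rightarrow> 'o"
  Idt :: "'o \<Rightarrow> 'a"
  Comp :: "'a \<Rightarrow> 'a \<Rightarrow> 'a" (infixl "\<cdot>\<index>" 70)

definition hom :: "('o, 'a, 'm) category_scheme \<Rightarrow> 'o \<Rightarrow> 'o \<Rightarrow> 'a set" where
  "hom C A B = {f \<in> Arr C. Dom C f = A \<and> Cod C f = B}"

locale category =
  fixes C :: "('o, 'a, 'm) category_scheme" (structure)
  assumes Dom_in: "f \<in> Arr C \<Longrightarrow> Dom C f \<in> Obj C"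
    and Cod_in: "f \<in> Arr C \<Longrightarrow> Cod C f \<in> Obj C"
    and Idt_in: "A \<in> Obj C \<Longrightarrow> Idt C A \<in> hom C A A"
    and Comp_in: "\<lbrakk>f \<in> Arr C; g \<in> Arr C; Dom C g = Cod C f\<rbrakk> \<Longrightarrow> g \<cdot> f \<in> hom C (Dom C f) (Cod C g)"
    and Comp_assoc: "\<lbrakk>f \<in> Arr C; g \<in> Arr C; h \<in> Arr C; Dom C g = Cod C f; Dom C h = Cod C g\<rbrakk>
                      \<Longrightarrow> (h \<cdot> g) \<cdot> f = h \<cdot> (g \<cdot> f)"
    and Idt_right: "f \<in> Arr C \<Longrightarrow> f \<cdot> Idt C (Dom C f) = f"
    and Idt_left: "f \<in> Arr C \<Longrightarrow> Idt C (Cod C f) \<cdot> f = f"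

definition iso_arr :: "('o, 'a, 'm) category_scheme \<Rightarrow> 'a \<Rightarrow> bool" where
  "iso_arr C f \<longleftrightarrow> f \<in> Arr C \<and>
     (\<exists>g \<in> hom C (Cod C f) (Dom C f). g \<cdot>\<^bsub>C\<^esub> f = Idt C (Dom C f) \<and> f \<cdot>\<^bsub>C\<^esub> g = Idt C (Cod C f))"

record ('o, 'a, 'p, 'b) cat_functor =
  FO :: "'o \<Rightarrow> 'p"
  FA :: "'a \<Rightarrow> 'b"

definition is_functor ::
  "('o, 'a, 'm) category_scheme \<Rightarrow> ('p, 'b, 'n) category_scheme \<Rightarrow> ('o, 'a, 'p, 'b) cat_functor \<Rightarrow> bool" where
  "is_functor C D F \<longleftrightarrow> category C \<and> category D \<and>
     (\<forall>A \<in> Obj C. FO F A \<in> Obj D) \<and>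
     (\<forall>f \<in> Arr C. FA F f \<in> hom D (FO F (Dom C f)) (FO F (Cod C f))) \<and>
     (\<forall>A \<in> Obj C. FA F (Idt C A) = Idt D (FO F A)) \<and>
     (\<forall>f \<in> Arr C. \<forall>g \<in> Arr C. Dom C g = Cod C f \<longrightarrow> FA F (g \<cdot>\<^bsub>C\<^esub> f) = FA F g \<cdot>\<^bsub>D\<^esub> FA F f)"

definition functor_comp ::
  "('p, 'b, 'q, 'c) cat_functor \<Rightarrow> ('o, 'a, 'p, 'b) cat_functor \<Rightarrow> ('o, 'a, 'q, 'c) cat_functor" where
  "functor_comp G F = \<lparr>FO = (\<lambda>A. FO G (FO F A)), FA = (\<lambda>f. FA G (FA F f))\<rparr>"

definition functor_eq ::
  "('o, 'a, 'm) category_scheme \<Rightarrow> ('o, 'a, 'p, 'b) cat_functor \<Rightarrow> ('o, 'a, 'p, 'b) cat_functor \<Rightarrow> bool" where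
  "functor_eq C F G \<longleftrightarrow> (\<forall>A \<in> Obj C. FO F A = FO G A) \<and> (\<forall>f \<in> Arr C. FA F f = FA G f)"

definition natural_iso ::
  "('o, 'a, 'm) category_scheme \<Rightarrow> ('p, 'b, 'n) category_scheme \<Rightarrow> ('o, 'a, 'p, 'b) cat_functor
    \<Rightarrow> ('o, 'a, 'p, 'b) cat_functor \<Rightarrow> ('o \<Rightarrow> 'b) \<Rightarrow> bool" where
  "natural_iso C D F G t \<longleftrightarrow> is_functor C D F \<and> is_functor C D G \<and>
     (\<forall>A \<in> Obj C. t A \<in> hom D (FO F A) (FO G A) \<and> iso_arr D (t A)) \<and>
     (\<forall>f \<in> Arr C. t (Cod C f) \<cdot>\<^bsub>D\<^esub> FA F f = FA G f \<cdot>\<^bsub>D\<^esub> t (Dom C f))"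

text \<open>Every finite category is isomorphic to one whose objects and arrows are natural numbers,
  so it suffices to take index categories of that type.\<close>

definition finite_category :: "(nat, nat) category \<Rightarrow> bool" where
  "finite_category J \<longleftrightarrow> category J \<and> finite (Obj J) \<and> finite (Arr J)"

definition is_cone ::
  "('o, 'a, 'm) category_scheme \<Rightarrow> (nat, nat) category \<Rightarrow> (nat, nat, 'o, 'a) cat_functor
    \<Rightarrow> 'o \<Rightarrow> (nat \<Rightarrow> 'a) \<Rightarrow> bool" where
  "is_cone C J F L \<pi> \<longleftrightarrow> L \<in> Obj C \<and> (\<forall>j \<in> Obj J. \<pi> j \<in> hom C L (FO F j)) \<and>
     (\<forall>u \<in> Arr J. FA F u \<cdot>\<^bsub>C\<^esub> \<pi> (Dom J u) = \<pi> (Cod J u))"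

definition is_limit ::
  "('o, 'a, 'm) category_scheme \<Rightarrow> (nat, nat) category \<Rightarrow> (nat, nat, 'o, 'a) cat_functor
    \<Rightarrow> 'o \<Rightarrow> (nat \<Rightarrow> 'a) \<Rightarrow> bool" where
  "is_limit C J F L \<pi> \<longleftrightarrow> is_cone C J F L \<pi> \<and>
     (\<forall>A \<tau>. is_cone C J F A \<tau> \<longrightarrow> (\<exists>!h. h \<in> hom C A L \<and> (\<forall>j \<in> Obj J. \<pi> j \<cdot>\<^bsub>C\<^esub> h = \<tau> j)))"

definition finitely_complete :: "('o, 'a, 'm) category_scheme \<Rightarrow> bool" where
  "finitely_complete C \<longleftrightarrow> category C \<and>
     (\<forall>J F. finite_category J \<and> is_functor J C F \<longrightarrow> (\<exists>L \<pi>. is_limit C J F L \<pi>))"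

definition left_exact ::
  "('o, 'a, 'm) category_scheme \<Rightarrow> ('p, 'b, 'n) category_scheme \<Rightarrow> ('o, 'a, 'p, 'b) cat_functor \<Rightarrow> bool" where
  "left_exact C D U \<longleftrightarrow> is_functor C D U \<and>
     (\<forall>J F L \<pi>. finite_category J \<and> is_functor J C F \<and> is_limit C J F L \<pi> \<longrightarrow>
        is_limit D J (functor_comp U F) (FO U L) (\<lambda>j. FA U (\<pi> j)))"

definition is_zero_obj :: "('o, 'a, 'm) category_scheme \<Rightarrow> 'o \<Rightarrow> bool" where
  "is_zero_obj C Z \<longleftrightarrow> Z \<in> Obj C \<and>
     (\<forall>A \<in> Obj C. (\<exists>!f. f \<in> hom C A Z) \<and> (\<exists>!f. f \<in> hom C Z A))"

definition zero_arr :: "('o, 'a, 'm) category_scheme \<Rightarrow> 'o \<Rightarrow> 'o \<Rightarrow> 'a" where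
  "zero_arr C A B = (THE h. \<exists>Z i j. is_zero_obj C Z \<and> j \<in> hom C A Z \<and> i \<in> hom C Z B \<and> h = i \<cdot>\<^bsub>C\<^esub> j)"

definition is_product :: "('o, 'a, 'm) category_scheme \<Rightarrow> 'o \<Rightarrow> 'o \<Rightarrow> 'o \<Rightarrow> 'a \<Rightarrow> 'a \<Rightarrow> bool" where
  "is_product C A B P p q \<longleftrightarrow> p \<in> hom C P A \<and> q \<in> hom C P B \<and>
     (\<forall>T \<in> Obj C. \<forall>f \<in> hom C T A. \<forall>g \<in> hom C T B.
        \<exists>!h. h \<in> hom C T P \<and> p \<cdot>\<^bsub>C\<^esub> h = f \<and> q \<cdot>\<^bsub>C\<^esub> h = g)"

definition is_kernel :: "('o, 'a, 'm) category_scheme \<Rightarrow> 'a \<Rightarrow> 'a \<Rightarrow> bool" where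
  "is_kernel C f k \<longleftrightarrow> k \<in> Arr C \<and> Cod C k = Dom C f \<and>
     f \<cdot>\<^bsub>C\<^esub> k = zero_arr C (Dom C k) (Cod C f) \<and>
     (\<forall>h \<in> Arr C. Cod C h = Dom C f \<and> f \<cdot>\<^bsub>C\<^esub> h = zero_arr C (Dom C h) (Cod C f) \<longrightarrow>
        (\<exists>!g. g \<in> hom C (Dom C h) (Dom C k) \<and> k \<cdot>\<^bsub>C\<^esub> g = h))"

text \<open>A finitely complete pointed category carries an arbitrary choice of a zero object, binary
  products and kernels, with respect to which products and \<open>Ker f = Dom (ker f)\<close> are
  formed. Functors are not required to respect these choices.\<close>

record ('o, 'a) chosen_category = "('o, 'a) category" +
  one :: 'o
  prd :: "'o \<Rightarrow> 'o \<Rightarrow> 'o"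
  pr1 :: "'o \<Rightarrow> 'o \<Rightarrow> 'a"
  pr2 :: "'o \<Rightarrow> 'o \<Rightarrow> 'a"
  ker :: "'a \<Rightarrow> 'a"

definition finitely_complete_pointed :: "('o, 'a) chosen_category \<Rightarrow> bool" where
  "finitely_complete_pointed C \<longleftrightarrow> finitely_complete C \<and> is_zero_obj C (one C) \<and>
     (\<forall>A \<in> Obj C. \<forall>B \<in> Obj C. is_product C A B (prd C A B) (pr1 C A B) (pr2 C A B)) \<and>
     (\<forall>f \<in> Arr C. is_kernel C f (ker C f))"

definition to_one :: "('o, 'a) chosen_category \<Rightarrow> 'o \<Rightarrow> 'a" where
  "to_one C A = (THE f. f \<in> hom C A (one C))"

definition tuple :: "('o, 'a) chosen_category \<Rightarrow> 'a \<Rightarrow> 'a \<Rightarrow> 'a" where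
  "tuple C f g = (THE h. h \<in> hom C (Dom C f) (prd C (Cod C f) (Cod C g)) \<and>
     pr1 C (Cod C f) (Cod C g) \<cdot>\<^bsub>C\<^esub> h = f \<and> pr2 C (Cod C f) (Cod C g) \<cdot>\<^bsub>C\<^esub> h = g)"

definition prod_arr :: "('o, 'a) chosen_category \<Rightarrow> 'a \<Rightarrow> 'a \<Rightarrow> 'a" where
  "prod_arr C f g = tuple C (f \<cdot>\<^bsub>C\<^esub> pr1 C (Dom C f) (Dom C g)) (g \<cdot>\<^bsub>C\<^esub> pr2 C (Dom C f) (Dom C g))"

text \<open>An arrow of \<open>Pt C\<close> is stored as \<open>(source, (x, y), target)\<close>, where \<open>x\<close> acts on the
  domains and \<open>y\<close> on the codomains of the split epimorphisms.\<close>

type_synonym 'a pt_obj = "'a \<times> 'a"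
type_synonym 'a pt_arr = "'a pt_obj \<times> ('a \<times> 'a) \<times> 'a pt_obj"

definition split_epis :: "('o, 'a, 'm) category_scheme \<Rightarrow> 'a pt_obj set" where
  "split_epis C = {(f, s). f \<in> Arr C \<and> s \<in> hom C (Cod C f) (Dom C f) \<and> f \<cdot>\<^bsub>C\<^esub> s = Idt C (Cod C f)}"

definition Pt :: "('o, 'a, 'm) category_scheme \<Rightarrow> ('a pt_obj, 'a pt_arr) category" where
  "Pt C = \<lparr>
     Obj = split_epis C,
     Arr = {((f, s), (x, y), (f', s')). (f, s) \<in> split_epis C \<and> (f', s') \<in> split_epis C \<and>
              x \<in> hom C (Dom C f) (Dom C f') \<and> y \<in> hom C (Cod C f) (Cod C f') \<and>
              f' \<cdot>\<^bsub>C\<^esub> x = y \<cdot>\<^bsub>C\<^esub> f \<and> x \<cdot>\<^bsub>C\<^esub> s = s' \<cdot>\<^bsub>C\<^esub> y},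
     Dom = (\<lambda>(p, m, q). p),
     Cod = (\<lambda>(p, m, q). q),
     Idt = (\<lambda>(f, s). ((f, s), (Idt C (Dom C f), Idt C (Cod C f)), (f, s))),
     Comp = (\<lambda>(p', (x', y'), q') (p, (x, y), q). (p, (x' \<cdot>\<^bsub>C\<^esub> x, y' \<cdot>\<^bsub>C\<^esub> y), q'))\<rparr>"

definition Pt_functor ::
  "('o, 'a, 'p, 'b) cat_functor \<Rightarrow> ('a pt_obj, 'a pt_arr, 'b pt_obj, 'b pt_arr) cat_functor" where
  "Pt_functor U = \<lparr>
     FO = (\<lambda>(f, s). (FA U f, FA U s)),
     FA = (\<lambda>((f, s), (x, y), (f', s')).
             ((FA U f, FA U s), (FA U x, FA U y), (FA U f', FA U s')))\<rparr>"

definition trivial_point :: "('p, 'b) chosen_category \<Rightarrow> 'p \<Rightarrow> 'p \<Rightarrow> 'b pt_obj" where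
  "trivial_point D Y K = (pr1 D Y K, tuple D (Idt D Y) (zero_arr D Y K))"

definition ker_map :: "('o, 'a) chosen_category \<Rightarrow> 'a \<Rightarrow> 'a \<Rightarrow> 'a \<Rightarrow> 'a" where
  "ker_map C f x f' = (THE h. h \<in> hom C (Dom C (ker C f)) (Dom C (ker C f')) \<and>
     ker C f' \<cdot>\<^bsub>C\<^esub> h = x \<cdot>\<^bsub>C\<^esub> ker C f)"

definition W_obj ::
  "('o, 'a) chosen_category \<Rightarrow> ('p, 'b) chosen_category \<Rightarrow> ('o, 'a, 'p, 'b) cat_functor
    \<Rightarrow> 'a \<Rightarrow> 'b pt_obj" where
  "W_obj C D U f = trivial_point D (FO U (Cod C f)) (FO U (Dom C (ker C f)))"

definition W_functor ::
  "('o, 'a) chosen_category \<Rightarrow> ('p, 'b) chosen_category \<Rightarrow> ('o, 'a, 'p, 'b) cat_functor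
    \<Rightarrow> ('a pt_obj, 'a pt_arr, 'b pt_obj, 'b pt_arr) cat_functor" where
  "W_functor C D U = \<lparr>
     FO = (\<lambda>(f, s). W_obj C D U f),
     FA = (\<lambda>((f, s), (x, y), (f', s')).
             (W_obj C D U f, (prod_arr D (FA U y) (FA U (ker_map C f x f')), FA U y), W_obj C D U f'))\<rparr>"

definition pt_top :: "'a pt_arr \<Rightarrow> 'a" where
  "pt_top = (\<lambda>(p, (x, y), q). x)"

definition pt_base :: "'a pt_arr \<Rightarrow> 'a" where
  "pt_base = (\<lambda>(p, (x, y), q). y)"

definition semi_direct_index ::
  "('o, 'a) chosen_category \<Rightarrow> ('p, 'b) chosen_category \<Rightarrow> ('o, 'a, 'p, 'b) cat_functor
    \<Rightarrow> ('a pt_obj \<Rightarrow> 'b pt_arr) \<Rightarrow> bool" where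
  "semi_direct_index C D U \<rho> \<longleftrightarrow>
     natural_iso (Pt C) (Pt D) (Pt_functor U) (W_functor C D U) \<rho> \<and>
     (\<forall>(f, s) \<in> split_epis C. iso_arr D (pt_top (\<rho> (f, s))) \<and>
        pt_base (\<rho> (f, s)) = Idt D (FO U (Cod C f)))"

definition index_gamma ::
  "('o, 'a) chosen_category \<Rightarrow> ('p, 'b) chosen_category \<Rightarrow> ('o, 'a, 'p, 'b) cat_functor
    \<Rightarrow> ('a pt_obj \<Rightarrow> 'b pt_arr) \<Rightarrow> 'a \<Rightarrow> 'a \<Rightarrow> 'b" where
  "index_gamma C D U \<rho> f s =
     pr2 D (FO U (Cod C f)) (FO U (Dom C (ker C f))) \<cdot>\<^bsub>D\<^esub> pt_top (\<rho> (f, s))"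

definition semi_direct_hyperindex ::
  "('o, 'a) chosen_category \<Rightarrow> ('p, 'b) chosen_category \<Rightarrow> ('o, 'a, 'p, 'b) cat_functor
    \<Rightarrow> ('a pt_obj \<Rightarrow> 'b pt_arr) \<Rightarrow> bool" where
  "semi_direct_hyperindex C D U \<rho> \<longleftrightarrow> semi_direct_index C D U \<rho> \<and>
     (\<forall>(f, s) \<in> split_epis C.
        index_gamma C D U \<rho> f s \<cdot>\<^bsub>D\<^esub> FA U (ker C f) = Idt D (FO U (Dom C (ker C f))))"

record ('o, 'a) setting =
  car :: 'o
  dop :: 'a
  cop :: 'a
  pnt :: 'a

definition hyper_slominski :: "('p, 'b) chosen_category \<Rightarrow> ('p, 'b) setting \<Rightarrow> bool" where
  "hyper_slominski D S \<longleftrightarrow> car S \<in> Obj D \<and>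
     dop S \<in> hom D (prd D (car S) (car S)) (car S) \<and>
     cop S \<in> hom D (prd D (car S) (car S)) (car S) \<and>
     pnt S \<in> hom D (one D) (car S) \<and>
     (\<forall>T \<in> Obj D. \<forall>x \<in> hom D T (car S). \<forall>z \<in> hom D T (car S).
        dop S \<cdot>\<^bsub>D\<^esub> tuple D (cop S \<cdot>\<^bsub>D\<^esub> tuple D x z) x = z \<and>
        cop S \<cdot>\<^bsub>D\<^esub> tuple D x (dop S \<cdot>\<^bsub>D\<^esub> tuple D z x) = z \<and>
        dop S \<cdot>\<^bsub>D\<^esub> tuple D x x = pnt S \<cdot>\<^bsub>D\<^esub> to_one D T)"

definition hypersubtraction :: "('p, 'b) chosen_category \<Rightarrow> ('p, 'b) setting \<Rightarrow> bool" where
  "hypersubtraction D S \<longleftrightarrow> hyper_slominski D S \<and>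
     (\<forall>T \<in> Obj D. \<forall>x \<in> hom D T (car S).
        dop S \<cdot>\<^bsub>D\<^esub> tuple D x (pnt S \<cdot>\<^bsub>D\<^esub> to_one D T) = x)"

definition preserves_ops ::
  "('p, 'b) chosen_category \<Rightarrow> ('p, 'b) setting \<Rightarrow> ('p, 'b) setting \<Rightarrow> 'b \<Rightarrow> bool" where
  "preserves_ops D S S' f \<longleftrightarrow>
     f \<cdot>\<^bsub>D\<^esub> dop S = dop S' \<cdot>\<^bsub>D\<^esub> prod_arr D f f \<and>
     f \<cdot>\<^bsub>D\<^esub> cop S = cop S' \<cdot>\<^bsub>D\<^esub> prod_arr D f f \<and>
     f \<cdot>\<^bsub>D\<^esub> pnt S = pnt S'"

text \<open>The category of the settings satisfying \<open>P\<close>; an arrow is stored as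
  \<open>(source, underlying arrow, target)\<close>.\<close>

type_synonym ('p, 'b) setting_arr = "('p, 'b) setting \<times> 'b \<times> ('p, 'b) setting"

definition settings ::
  "('p, 'b) chosen_category \<Rightarrow> (('p, 'b) setting \<Rightarrow> bool)
    \<Rightarrow> (('p, 'b) setting, ('p, 'b) setting_arr) category" where
  "settings D P = \<lparr>
     Obj = {S. P S},
     Arr = {(S, f, S'). P S \<and> P S' \<and> f \<in> hom D (car S) (car S') \<and> preserves_ops D S S' f},
     Dom = (\<lambda>(S, f, S'). S),
     Cod = (\<lambda>(S, f, S'). S'),
     Idt = (\<lambda>S. (S, Idt D (car S), S)),
     Comp = (\<lambda>(S', g, S'') (S, f, S1). (S, g \<cdot>\<^bsub>D\<^esub> f, S''))\<rparr>"

definition Slom :: "('p, 'b) chosen_category \<Rightarrow> (('p, 'b) setting, ('p, 'b) setting_arr) category" where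
  "Slom D = settings D (hyper_slominski D)"

definition HSt :: "('p, 'b) chosen_category \<Rightarrow> (('p, 'b) setting, ('p, 'b) setting_arr) category" where
  "HSt D = settings D (hypersubtraction D)"

text \<open>The forgetful functor to \<open>D\<close>, both for \<open>Slom D\<close> and for \<open>HSt D\<close>.\<close>

definition forgetful ::
  "(('p, 'b) setting, ('p, 'b) setting_arr, 'p, 'b) cat_functor" where
  "forgetful = \<lparr>FO = car, FA = (\<lambda>(S, f, S'). f)\<rparr>"

text \<open>The canonical index at a split epimorphism \<open>(f, s)\<close> of settings, formed with respect
  to a given kernel \<open>k\<close> of \<open>f\<close> in the category of settings. The element \<open>d(x, sf(x))\<close> of
  \<open>Ker f\<close> is the \<open>g\<close> with \<open>k g = d \<langle>Id, sf\<rangle>\<close>. The same formula serves for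
  \<open>Slom D\<close> and for \<open>HSt D\<close>.\<close>

definition canonical_gamma ::
  "('p, 'b) chosen_category \<Rightarrow> ('p, 'b) setting_arr \<Rightarrow> ('p, 'b) setting_arr \<Rightarrow> ('p, 'b) setting_arr \<Rightarrow> 'b" where
  "canonical_gamma D = (\<lambda>(X, f, Y) (Y', s, X') (K, k, X'').
     (THE g. g \<in> hom D (car X) (car K) \<and>
        k \<cdot>\<^bsub>D\<^esub> g = dop X \<cdot>\<^bsub>D\<^esub> tuple D (Idt D (car X)) (s \<cdot>\<^bsub>D\<^esub> f)))"

definition canonical_index ::
  "('p, 'b) chosen_category \<Rightarrow> ('p, 'b) setting_arr pt_obj \<Rightarrow> ('p, 'b) setting_arr \<Rightarrow> 'b pt_arr" where
  "canonical_index D = (\<lambda>((X, f, Y), (Y', s, X')) (K, k, X'').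
     ((f, s),
      (tuple D f (canonical_gamma D (X, f, Y) (Y', s, X') (K, k, X'')), Idt D (car Y)),
      trivial_point D (car Y) (car K)))"

text \<open>\<open>V\<close> is a factorization of \<open>U\<close> through the settings category \<open>E\<close> with
  \<open>\<rho> = \<rho>\<^sub>E . V\<close>. For the two sides to have the same target, the canonical index at \<open>(V f, V s)\<close> has to be
  formed with the kernel \<open>V k\<^sub>f\<close>, whose underlying object is \<open>U (Ker f)\<close>.\<close>

definition index_factorization ::
  "('o, 'a) chosen_category \<Rightarrow> ('p, 'b) chosen_category \<Rightarrow> ('o, 'a, 'p, 'b) cat_functor
    \<Rightarrow> ('a pt_obj \<Rightarrow> 'b pt_arr) \<Rightarrow> (('p, 'b) setting, ('p, 'b) setting_arr) category
    \<Rightarrow> ('o, 'a, ('p, 'b) setting, ('p, 'b) setting_arr) cat_functor \<Rightarrow> bool" where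
  "index_factorization C D U \<rho> E V \<longleftrightarrow>
     is_functor C E V \<and> functor_eq C U (functor_comp forgetful V) \<and>
     (\<forall>(f, s) \<in> split_epis C.
        is_kernel E (FA V f) (FA V (ker C f)) \<and>
        \<rho> (f, s) = canonical_index D (FA V f, FA V s) (FA V (ker C f)))"

end

theory Submission
  imports Defs
begin

text \<open>For an object \<open>X\<close>, the split epimorphism \<open>(p\<^sub>2, \<Delta>) : X \<times> X \<rightleftarrows> X\<close> has kernel \<open>X\<close>,
  so \<open>\<gamma>\<close> at this point is an arrow \<open>d : U X \<times> U X \<rightarrow> U X\<close> which vanishes on the diagonal, and
  \<open>(p\<^sub>2, d)\<close> is invertible because \<open>\<rho>\<close> is. This makes \<open>U X\<close> a hyper-Slominski setting, and naturality of
  \<open>\<rho>\<close> along \<open>(h \<times> h, h)\<close> shows that \<open>U h\<close> preserves \<open>d\<close>. Any point \<open>(f, s)\<close> maps to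
  \<open>(p\<^sub>2, \<Delta>)\<close> by \<open>(\<langle>Id, sf\<rangle>, s)\<close>, and naturality along this morphism says that
  \<open>\<gamma>\<close> at \<open>(f, s)\<close> is \<open>x \<mapsto> d(x, sf(x))\<close>. If \<open>\<gamma> U(k) = Id\<close> at \<open>(p\<^sub>2, \<Delta>)\<close>, then
  \<open>d(x, 1) = x\<close>.\<close>

section \<open>Categories and zero arrows\<close>

context category
begin

lemma comp_arr [simp]:
  assumes "f \<in> Arr C" "g \<in> Arr C" "Dom C g = Cod C f"
  shows "g \<cdot> f \<in> Arr C" "Dom C (g \<cdot> f) = Dom C f" "Cod C (g \<cdot> f) = Cod C g"
  using Comp_in[OF assms] by (auto simp: hom_def)

lemma idt_arr [simp]:
  assumes "A \<in> Obj C"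
  shows "Idt C A \<in> Arr C" "Dom C (Idt C A) = A" "Cod C (Idt C A) = A"
  using Idt_in[OF assms] by (auto simp: hom_def)

lemma dom_cod_obj [simp]: "f \<in> Arr C \<Longrightarrow> Dom C f \<in> Obj C" "f \<in> Arr C \<Longrightarrow> Cod C f \<in> Obj C"
  by (rule Dom_in, assumption) (rule Cod_in)

lemma comp_idt [simp]:
  "f \<in> Arr C \<Longrightarrow> Dom C f = A \<Longrightarrow> f \<cdot> Idt C A = f"
  "f \<in> Arr C \<Longrightarrow> Cod C f = A \<Longrightarrow> Idt C A \<cdot> f = f"
  using Idt_right Idt_left by auto

text \<open>As a rewrite rule this nests composites to the right. Later proofs therefore regroup two
  adjacent factors explicitly before replacing them by an equation.\<close>

lemma comp_assoc [simp]:
  "\<lbrakk>f \<in> Arr C; g \<in> Arr C; h \<in> Arr C; Dom C g = Cod C f; Dom C h = Cod C g\<rbrakk>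
    \<Longrightarrow> (h \<cdot> g) \<cdot> f = h \<cdot> (g \<cdot> f)"
  by (rule Comp_assoc)

lemma hom_obj: "f \<in> hom C A B \<Longrightarrow> A \<in> Obj C" "f \<in> hom C A B \<Longrightarrow> B \<in> Obj C"
  by (auto simp: hom_def)

lemma zero_obj_ex1:
  assumes "is_zero_obj C Z" "A \<in> Obj C"
  shows "\<exists>!f. f \<in> hom C A Z" "\<exists>!f. f \<in> hom C Z A"
  using assms by (simp_all add: is_zero_obj_def)

lemma to_zero_unique: "is_zero_obj C Z \<Longrightarrow> f \<in> hom C A Z \<Longrightarrow> g \<in> hom C A Z \<Longrightarrow> f = g"
  using zero_obj_ex1(1)[of Z A] hom_obj(1)[of f A Z] by auto

lemma from_zero_unique: "is_zero_obj C Z \<Longrightarrow> f \<in> hom C Z A \<Longrightarrow> g \<in> hom C Z A \<Longrightarrow> f = g"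
  using zero_obj_ex1(2)[of Z A] hom_obj(2)[of f Z A] by auto

lemma product_ex1:
  assumes "is_product C A B Q p q" "f \<in> hom C T A" "g \<in> hom C T B"
  shows "\<exists>!h. h \<in> hom C T Q \<and> p \<cdot> h = f \<and> q \<cdot> h = g"
  using assms hom_obj(1)[OF assms(2)] by (simp add: is_product_def)

text \<open>\<open>zero_arr\<close> is described through arbitrary zero objects, so factorizations
  through different ones must agree. A map \<open>u\<close> between the zero objects carries one
  factorization to the other, because arrows into and out of a zero object are unique.\<close>

lemma zero_arr_eq:
  assumes Z: "is_zero_obj C Z" and j: "j \<in> hom C A Z" and i: "i \<in> hom C Z B"
  shows "zero_arr C A B = i \<cdot> j"
  unfolding zero_arr_def
proof (rule the_equality)
  show "\<exists>Z i' j'. is_zero_obj C Z \<and> j' \<in> hom C A Z \<and> i' \<in> hom C Z B \<and> i \<cdot> j = i' \<cdot> j'"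
    using assms by blast
next
  fix h assume "\<exists>Z i j. is_zero_obj C Z \<and> j \<in> hom C A Z \<and> i \<in> hom C Z B \<and> h = i \<cdot> j"
  then obtain Z' i' j' where Z': "is_zero_obj C Z'" and j': "j' \<in> hom C A Z'"
    and i': "i' \<in> hom C Z' B" and h: "h = i' \<cdot> j'" by blast
  obtain u where u: "u \<in> hom C Z' Z"
    using zero_obj_ex1(1)[OF Z, of Z'] Z' by (auto simp: is_zero_obj_def)
  have "u \<cdot> j' \<in> hom C A Z" "i \<cdot> u \<in> hom C Z' B"
    using u i j' by (auto simp: hom_def)
  then have "u \<cdot> j' = j" "i \<cdot> u = i'"
    using to_zero_unique[OF Z _ j] from_zero_unique[OF Z' _ i'] by auto
  then show "h = i \<cdot> j"
    using h u i j' by (auto simp: hom_def)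
qed

end

section \<open>Zero arrows with respect to the chosen zero object\<close>

locale pointed_category =
  fixes C :: "('o, 'a) chosen_category" (structure)
  assumes finitely_complete_pointed: "finitely_complete_pointed C"

sublocale pointed_category \<subseteq> category C
  using finitely_complete_pointed
  by (simp add: finitely_complete_pointed_def finitely_complete_def)

context pointed_category
begin

lemma zero_obj: "is_zero_obj C (one C)"
  and product: "A \<in> Obj C \<Longrightarrow> B \<in> Obj C \<Longrightarrow> is_product C A B (prd C A B) (pr1 C A B) (pr2 C A B)"
  and kernel: "f \<in> Arr C \<Longrightarrow> is_kernel C f (ker C f)"
  using finitely_complete_pointed by (auto simp: finitely_complete_pointed_def)

lemma one_obj [simp]: "one C \<in> Obj C"
  using zero_obj by (simp add: is_zero_obj_def)

lemma to_one_hom: "A \<in> Obj C \<Longrightarrow> to_one C A \<in> hom C A (one C)"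
  unfolding to_one_def by (rule theI') (rule zero_obj_ex1(1)[OF zero_obj])

lemma to_one_arr [simp]:
  "A \<in> Obj C \<Longrightarrow> to_one C A \<in> Arr C"
  "A \<in> Obj C \<Longrightarrow> Dom C (to_one C A) = A"
  "A \<in> Obj C \<Longrightarrow> Cod C (to_one C A) = one C"
  using to_one_hom by (auto simp: hom_def)

lemma to_one_unique: "f \<in> hom C A (one C) \<Longrightarrow> g \<in> hom C A (one C) \<Longrightarrow> f = g"
  by (rule to_zero_unique[OF zero_obj])

lemma from_one_unique: "f \<in> hom C (one C) A \<Longrightarrow> g \<in> hom C (one C) A \<Longrightarrow> f = g"
  by (rule from_zero_unique[OF zero_obj])

lemma zero_arr_via_one:
  "i \<in> hom C (one C) B \<Longrightarrow> A \<in> Obj C \<Longrightarrow> zero_arr C A B = i \<cdot> to_one C A"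
  by (rule zero_arr_eq[OF zero_obj to_one_hom])

lemma from_one_exists: "B \<in> Obj C \<Longrightarrow> \<exists>i. i \<in> hom C (one C) B"
  using zero_obj_ex1(2)[OF zero_obj] by (rule ex1_implies_ex)

lemma zero_arr_arr [simp]:
  assumes "A \<in> Obj C" "B \<in> Obj C"
  shows "zero_arr C A B \<in> Arr C" "Dom C (zero_arr C A B) = A" "Cod C (zero_arr C A B) = B"
proof -
  obtain i where "i \<in> hom C (one C) B" using from_one_exists[OF assms(2)] by auto
  then show "zero_arr C A B \<in> Arr C" "Dom C (zero_arr C A B) = A" "Cod C (zero_arr C A B) = B"
    using zero_arr_via_one[of i] assms by (auto simp: hom_def)
qed

lemma zero_arr_comp [simp]:
  assumes "f \<in> Arr C" "Cod C f = A" "B \<in> Obj C"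
  shows "zero_arr C A B \<cdot> f = zero_arr C (Dom C f) B"
proof -
  obtain i where i: "i \<in> hom C (one C) B" using from_one_exists[OF assms(3)] by auto
  have "to_one C A \<cdot> f = to_one C (Dom C f)"
    by (rule to_one_unique[of _ "Dom C f"]) (use assms in \<open>auto simp: hom_def\<close>)
  then show ?thesis
    using i assms zero_arr_via_one[OF i, of A] zero_arr_via_one[OF i, of "Dom C f"]
    by (auto simp: hom_def)
qed

lemma comp_zero_arr [simp]:
  assumes "g \<in> Arr C" "Dom C g = B" "A \<in> Obj C"
  shows "g \<cdot> zero_arr C A B = zero_arr C A (Cod C g)"
proof -
  obtain i where i: "i \<in> hom C (one C) B" using from_one_exists[of B] assms by auto
  then have "g \<cdot> i \<in> hom C (one C) (Cod C g)" using assms by (auto simp: hom_def)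
  from zero_arr_via_one[OF this, of A] show ?thesis
    using i assms zero_arr_via_one[OF i, of A] by (auto simp: hom_def)
qed

section \<open>Tuples and kernels\<close>

lemma pr_arr [simp]:
  assumes "A \<in> Obj C" "B \<in> Obj C"
  shows "pr1 C A B \<in> Arr C" "Dom C (pr1 C A B) = prd C A B" "Cod C (pr1 C A B) = A"
    "pr2 C A B \<in> Arr C" "Dom C (pr2 C A B) = prd C A B" "Cod C (pr2 C A B) = B"
    "prd C A B \<in> Obj C"
  using product[OF assms] hom_obj(1)[of "pr1 C A B" "prd C A B"]
  by (auto simp: is_product_def hom_def)

lemma tuple_props:
  assumes "f \<in> Arr C" "g \<in> Arr C" "Dom C f = Dom C g"
  shows "tuple C f g \<in> hom C (Dom C f) (prd C (Cod C f) (Cod C g)) \<and>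
    pr1 C (Cod C f) (Cod C g) \<cdot> tuple C f g = f \<and> pr2 C (Cod C f) (Cod C g) \<cdot> tuple C f g = g"
proof -
  have "f \<in> hom C (Dom C f) (Cod C f)" "g \<in> hom C (Dom C f) (Cod C g)"
    using assms by (auto simp: hom_def)
  then show ?thesis
    unfolding tuple_def using assms
    by - (rule theI', rule product_ex1[OF product], simp_all)
qed

lemma tuple_arr [simp]:
  assumes "f \<in> Arr C" "g \<in> Arr C" "Dom C f = Dom C g"
  shows "tuple C f g \<in> Arr C" "Dom C (tuple C f g) = Dom C g"
    "Cod C (tuple C f g) = prd C (Cod C f) (Cod C g)"
  using tuple_props[OF assms] assms by (auto simp: hom_def)

lemma pr_tuple [simp]:
  assumes "f \<in> Arr C" "g \<in> Arr C" "Dom C f = Dom C g" "Cod C f = A" "Cod C g = B"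
  shows "pr1 C A B \<cdot> tuple C f g = f" "pr2 C A B \<cdot> tuple C f g = g"
  using tuple_props[OF assms(1-3)] assms by auto

lemma prd_eqI:
  assumes "h \<in> hom C T (prd C A B)" "h' \<in> hom C T (prd C A B)" "A \<in> Obj C" "B \<in> Obj C"
    and "pr1 C A B \<cdot> h = pr1 C A B \<cdot> h'" "pr2 C A B \<cdot> h = pr2 C A B \<cdot> h'"
  shows "h = h'"
proof -
  have "pr1 C A B \<cdot> h \<in> hom C T A" "pr2 C A B \<cdot> h \<in> hom C T B"
    using assms by (auto simp: hom_def)
  then have "\<exists>!k. k \<in> hom C T (prd C A B) \<and> pr1 C A B \<cdot> k = pr1 C A B \<cdot> h
      \<and> pr2 C A B \<cdot> k = pr2 C A B \<cdot> h"
    by (rule product_ex1[OF product[OF assms(3,4)]])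
  then show ?thesis using assms by metis
qed

text \<open>Both sides have the same projections. The orientation pushes composition inside tuples,
  so that the simplifier computes with generalized elements componentwise.\<close>

lemma tuple_comp [simp]:
  assumes "f \<in> Arr C" "g \<in> Arr C" "Dom C f = Dom C g" "h \<in> Arr C" "Cod C h = Dom C g"
  shows "tuple C f g \<cdot> h = tuple C (f \<cdot> h) (g \<cdot> h)"
proof (rule prd_eqI)
  show "pr1 C (Cod C f) (Cod C g) \<cdot> (tuple C f g \<cdot> h) = pr1 C (Cod C f) (Cod C g) \<cdot> tuple C (f \<cdot> h) (g \<cdot> h)"
    "pr2 C (Cod C f) (Cod C g) \<cdot> (tuple C f g \<cdot> h) = pr2 C (Cod C f) (Cod C g) \<cdot> tuple C (f \<cdot> h) (g \<cdot> h)"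
    using assms by (simp_all flip: comp_assoc)
qed (use assms in \<open>auto simp: hom_def\<close>)

lemma tuple_eta:
  assumes "h \<in> hom C T (prd C A B)" "A \<in> Obj C" "B \<in> Obj C"
  shows "tuple C (pr1 C A B \<cdot> h) (pr2 C A B \<cdot> h) = h"
  by (rule prd_eqI[of _ T A B]) (use assms in \<open>auto simp: hom_def\<close>)

lemma prod_arr_arr [simp]:
  assumes "f \<in> Arr C" "g \<in> Arr C"
  shows "prod_arr C f g \<in> Arr C" "Dom C (prod_arr C f g) = prd C (Dom C f) (Dom C g)"
    "Cod C (prod_arr C f g) = prd C (Cod C f) (Cod C g)"
  using assms by (auto simp: prod_arr_def)

lemma prod_arr_tuple [simp]:
  assumes "f \<in> Arr C" "g \<in> Arr C" "a \<in> Arr C" "b \<in> Arr C" "Dom C a = Dom C b"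
    "Cod C a = Dom C f" "Cod C b = Dom C g"
  shows "prod_arr C f g \<cdot> tuple C a b = tuple C (f \<cdot> a) (g \<cdot> b)"
  using assms by (auto simp: prod_arr_def)

section \<open>Kernels and the maps induced between them\<close>

lemma kernel_ex1:
  assumes "is_kernel C f k" "h \<in> Arr C" "Dom C h = T" "Cod C h = Dom C f"
    and "f \<cdot> h = zero_arr C T (Cod C f)"
  shows "\<exists>!g. g \<in> hom C T (Dom C k) \<and> k \<cdot> g = h"
  using assms(1)[unfolded is_kernel_def, THEN conjunct2, THEN conjunct2, THEN conjunct2,
    THEN bspec[OF _ assms(2)]] assms(3-)
  by simp

text \<open>The composite \<open>k g\<close> is killed by \<open>f\<close>, so it factors through
  \<open>k\<close> in only one way; \<open>g\<close> and \<open>g'\<close> are both such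
  factorizations.\<close>

lemma kernel_mono:
  assumes k: "is_kernel C f k" and f: "f \<in> Arr C"
    and g: "g \<in> hom C T (Dom C k)" "g' \<in> hom C T (Dom C k)" and eq: "k \<cdot> g = k \<cdot> g'"
  shows "g = g'"
proof -
  have kk: "k \<in> Arr C" "Cod C k = Dom C f" "f \<cdot> k = zero_arr C (Dom C k) (Cod C f)"
    using k by (auto simp: is_kernel_def)
  have "f \<cdot> (k \<cdot> g) = zero_arr C T (Cod C f)"
    using kk f g by (auto simp: hom_def simp flip: comp_assoc)
  moreover have "k \<cdot> g \<in> Arr C" "Cod C (k \<cdot> g) = Dom C f" "Dom C (k \<cdot> g) = T"
    using kk f g by (auto simp: hom_def)
  ultimately have "\<exists>!h. h \<in> hom C T (Dom C k) \<and> k \<cdot> h = k \<cdot> g"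
    by (intro kernel_ex1[OF k])
  then show ?thesis using g eq by metis
qed

lemma ker_arr [simp]:
  assumes "f \<in> Arr C"
  shows "ker C f \<in> Arr C" "Cod C (ker C f) = Dom C f"
    "f \<cdot> ker C f = zero_arr C (Dom C (ker C f)) (Cod C f)"
  using kernel[OF assms] by (auto simp: is_kernel_def)

text \<open>With \<open>k\<close> the kernel of \<open>f\<close>, \<open>f' x k = y f k = 0\<close>,
  so \<open>x k\<close> factors uniquely through the kernel of \<open>f'\<close>. This justifies the
  description in \<open>ker_map\<close>.\<close>

lemma ker_map_props:
  assumes "f \<in> Arr C" "f' \<in> Arr C" "x \<in> hom C (Dom C f) (Dom C f')"
    and "y \<in> hom C (Cod C f) (Cod C f')" "f' \<cdot> x = y \<cdot> f"
  shows "ker_map C f x f' \<in> hom C (Dom C (ker C f)) (Dom C (ker C f')) \<and>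
    ker C f' \<cdot> ker_map C f x f' = x \<cdot> ker C f"
  unfolding ker_map_def
proof (rule theI')
  have "f' \<cdot> (x \<cdot> ker C f) = (f' \<cdot> x) \<cdot> ker C f"
    using assms(1-4) by (simp add: hom_def)
  also have "\<dots> = zero_arr C (Dom C (ker C f)) (Cod C f')"
    unfolding assms(5) using assms(1-4) by (simp add: hom_def)
  finally show "\<exists>!h. h \<in> hom C (Dom C (ker C f)) (Dom C (ker C f')) \<and>
      ker C f' \<cdot> h = x \<cdot> ker C f"
    by (intro kernel_ex1[OF kernel[OF assms(2)]]) (use assms(1,3) in \<open>simp_all add: hom_def\<close>)
qed

section \<open>Categories of settings\<close>

lemma hyper_slominskiD:
  assumes "hyper_slominski C S"
  shows "car S \<in> Obj C" "dop S \<in> Arr C" "Dom C (dop S) = prd C (car S) (car S)" "Cod C (dop S) = car S"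
    "cop S \<in> Arr C" "Dom C (cop S) = prd C (car S) (car S)" "Cod C (cop S) = car S"
    "pnt S \<in> Arr C" "Dom C (pnt S) = one C" "Cod C (pnt S) = car S"
  using assms by (auto simp: hyper_slominski_def hom_def)

text \<open>A constant given by the point factors through the zero object, so the value of
  \<open>d(x, x)\<close> can be written with \<open>zero_arr\<close>, which the simplifier can
  compose.\<close>

lemma hyper_slominski_ops:
  assumes "hyper_slominski C S" "x \<in> Arr C" "z \<in> Arr C" "Dom C x = Dom C z"
    "Cod C x = car S" "Cod C z = car S"
  shows "dop S \<cdot> tuple C (cop S \<cdot> tuple C x z) x = z"
    "cop S \<cdot> tuple C x (dop S \<cdot> tuple C z x) = z"
    "dop S \<cdot> tuple C x x = zero_arr C (Dom C x) (car S)"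
proof -
  have "x \<in> hom C (Dom C x) (car S)" "z \<in> hom C (Dom C x) (car S)" "Dom C x \<in> Obj C"
    using assms by (auto simp: hom_def)
  moreover have "pnt S \<in> hom C (one C) (car S)"
    using assms(1) by (simp add: hyper_slominski_def)
  ultimately show "dop S \<cdot> tuple C (cop S \<cdot> tuple C x z) x = z"
    "cop S \<cdot> tuple C x (dop S \<cdot> tuple C z x) = z"
    "dop S \<cdot> tuple C x x = zero_arr C (Dom C x) (car S)"
    using assms(1) by (auto simp: hyper_slominski_def zero_arr_via_one)
qed

text \<open>The operation \<open>\<circ>\<close> is determined by \<open>d\<close>, and the point is the zero arrow.\<close>

lemma preserves_opsI:
  assumes S: "hyper_slominski C S" and S': "hyper_slominski C S'"
    and f: "f \<in> hom C (car S) (car S')"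
    and d: "f \<cdot> dop S = dop S' \<cdot> prod_arr C f f"
  shows "preserves_ops C S S' f"
proof -
  note [simp] = hyper_slominskiD[OF S] hyper_slominskiD[OF S']
  have [simp]: "f \<in> Arr C" "Dom C f = car S" "Cod C f = car S'"
    using f by (auto simp: hom_def)
  have fd: "f \<cdot> (dop S \<cdot> tuple C a b) = dop S' \<cdot> tuple C (f \<cdot> a) (f \<cdot> b)"
    if "a \<in> Arr C" "b \<in> Arr C" "Dom C a = Dom C b" "Cod C a = car S" "Cod C b = car S" for a b
  proof -
    have "f \<cdot> (dop S \<cdot> tuple C a b) = (f \<cdot> dop S) \<cdot> tuple C a b"
      using that by simp
    then show ?thesis using that unfolding d by simp
  qed
  \<comment> \<open>The projections are the generic pair of elements, and \<open>?c\<close> is the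
    generic value of \<circ>.\<close>
  let ?x = "pr1 C (car S) (car S)" and ?z = "pr2 C (car S) (car S)"
  let ?c = "cop S \<cdot> tuple C ?x ?z"
  have pr: "tuple C ?x ?z = Idt C (prd C (car S) (car S))"
    using tuple_eta[of "Idt C (prd C (car S) (car S))" "prd C (car S) (car S)" "car S" "car S"]
    by (simp add: hom_def)
  \<comment> \<open>Write \<open>f(x \<circ> z)\<close> as
    \<open>f x \<circ> d(f(x \<circ> z), f x)\<close>. As \<open>f\<close> preserves
    \<open>d\<close>, the second argument is \<open>f(d(x \<circ> z, x)) = f z\<close>.\<close>
  have "f \<cdot> ?c = cop S' \<cdot> tuple C (f \<cdot> ?x) (dop S' \<cdot> tuple C (f \<cdot> ?c) (f \<cdot> ?x))"
    by (rule hyper_slominski_ops(2)[OF S', symmetric]) simp_all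
  also have "dop S' \<cdot> tuple C (f \<cdot> ?c) (f \<cdot> ?x) = f \<cdot> (dop S \<cdot> tuple C ?c ?x)"
    by (rule fd[symmetric]) simp_all
  also have "dop S \<cdot> tuple C ?c ?x = ?z"
    by (rule hyper_slominski_ops(1)[OF S]) simp_all
  finally have "f \<cdot> cop S = cop S' \<cdot> prod_arr C f f"
    by (simp add: pr prod_arr_def)
  moreover have "f \<cdot> pnt S = pnt S'"
    by (rule from_one_unique[of _ "car S'"]) (simp_all add: hom_def)
  ultimately show ?thesis using d by (simp add: preserves_ops_def)
qed

text \<open>This will be the zero object of the categories of settings, through which zero arrows
  and kernels are computed there.\<close>

definition trivial_setting :: "('o, 'a) setting" where
  "trivial_setting = \<lparr>car = one C, dop = to_one C (prd C (one C) (one C)),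
     cop = to_one C (prd C (one C) (one C)), pnt = Idt C (one C)\<rparr>"

lemma hypersubtraction_trivial: "hypersubtraction C trivial_setting"
  unfolding hypersubtraction_def hyper_slominski_def trivial_setting_def
  by (auto simp: hom_def intro!: to_one_unique)

lemma hypersubtraction_imp: "hypersubtraction C S \<Longrightarrow> hyper_slominski C S"
  by (simp add: hypersubtraction_def)

end

text \<open>\<open>P\<close> stands for \<open>hyper_slominski C\<close> or
  \<open>hypersubtraction C\<close>, so that both categories of settings are handled at
  once.\<close>

locale settings_category = pointed_category +
  fixes P :: "('a, 'b) setting \<Rightarrow> bool"
  assumes P_imp: "P S \<Longrightarrow> hyper_slominski C S"
    and P_trivial: "P trivial_setting"
begin

text \<open>\<open>preserves_opsI\<close> recovers the preservation of \<open>cop\<close> and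
  \<open>pnt\<close> from that of \<open>dop\<close>, leaving a single equation to check.\<close>

lemma settings_arr:
  "(S, f, S') \<in> Arr (settings C P) \<longleftrightarrow>
    P S \<and> P S' \<and> f \<in> hom C (car S) (car S') \<and> f \<cdot> dop S = dop S' \<cdot> prod_arr C f f"
  using preserves_opsI[OF P_imp P_imp, of S S' f] by (auto simp: settings_def preserves_ops_def)

lemma settings_simps [simp]:
  "Obj (settings C P) = Collect P"
  "Dom (settings C P) (S, f, S') = S" "Cod (settings C P) (S, f, S') = S'"
  "Idt (settings C P) S = (S, Idt C (car S), S)"
  "Comp (settings C P) (S2, g, S3) (S, f, S1) = (S, g \<cdot> f, S3)"
  by (simp_all add: settings_def)

lemma category_settings: "category (settings C P)"
proof (unfold_locales, goal_cases)
  \<comment> \<open>Identity arrows: the product of two identities is an identity, by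
    \<open>tuple_eta\<close>. The next case is composition.\<close>
  case (3 S)
  then have "hyper_slominski C S" by (simp add: P_imp)
  note [simp] = hyper_slominskiD[OF this]
  have "prod_arr C (Idt C (car S)) (Idt C (car S)) = Idt C (prd C (car S) (car S))"
    using tuple_eta[of "Idt C (prd C (car S) (car S))" "prd C (car S) (car S)" "car S" "car S"]
    by (simp add: hom_def prod_arr_def)
  with 3 show ?case by (simp add: hom_def settings_arr)
next
  case (4 a b)
  obtain S f S1 S2 g S3 where ab: "a = (S, f, S1)" "b = (S2, g, S3)" by (metis prod_cases3)
  with 4 have P: "P S" "P S1" "P S3" "S2 = S1" by (auto simp: settings_arr)
  note [simp] = P(4) hyper_slominskiD[OF P_imp[OF P(1)]] hyper_slominskiD[OF P_imp[OF P(2)]]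
    hyper_slominskiD[OF P_imp[OF P(3)]]
  have [simp]: "f \<in> Arr C" "Dom C f = car S" "Cod C f = car S1"
    "g \<in> Arr C" "Dom C g = car S1" "Cod C g = car S3"
    and f: "f \<cdot> dop S = dop S1 \<cdot> prod_arr C f f" and g: "g \<cdot> dop S1 = dop S3 \<cdot> prod_arr C g g"
    using 4 ab by (auto simp: settings_arr hom_def)
  have "(g \<cdot> f) \<cdot> dop S = g \<cdot> (dop S1 \<cdot> prod_arr C f f)"
    by (simp add: f)
  also have "\<dots> = (g \<cdot> dop S1) \<cdot> prod_arr C f f"
    by simp
  also have "\<dots> = dop S3 \<cdot> prod_arr C (g \<cdot> f) (g \<cdot> f)"
    unfolding g by (simp add: prod_arr_def)
  finally show ?case using ab P by (simp add: hom_def settings_arr)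
qed (auto simp: settings_arr settings_def hom_def)

text \<open>The arrow into the trivial setting preserves \<open>d\<close> because its codomain is
  terminal. The arrow out of it is the point of \<open>S\<close>, which preserves \<open>d\<close>
  because \<open>d(1, 1) = 1\<close>.\<close>

lemma zero_obj_settings: "is_zero_obj (settings C P) trivial_setting"
  unfolding is_zero_obj_def
proof (intro conjI ballI)
  show "trivial_setting \<in> Obj (settings C P)" by (simp add: P_trivial)
  fix S assume "S \<in> Obj (settings C P)"
  then have P: "P S" by simp
  note [simp] = hyper_slominskiD[OF P_imp[OF P]] hyper_slominskiD[OF P_imp[OF P_trivial]]
  have [simp]: "car trivial_setting = one C" by (simp add: trivial_setting_def)
  have "to_one C (car S) \<cdot> dop S = dop trivial_setting \<cdot> prod_arr C (to_one C (car S)) (to_one C (car S))"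
    by (rule to_one_unique[of _ "prd C (car S) (car S)"]) (simp_all add: hom_def)
  then have "(S, to_one C (car S), trivial_setting) \<in> hom (settings C P) S trivial_setting"
    by (simp add: hom_def settings_arr P P_trivial)
  moreover have "a = (S, to_one C (car S), trivial_setting)"
    if "a \<in> hom (settings C P) S trivial_setting" for a
    using that to_one_unique[of _ "car S" "to_one C (car S)"]
    by (cases a) (auto simp: hom_def settings_arr)
  ultimately show "\<exists>!f. f \<in> hom (settings C P) S trivial_setting" by blast
  let ?q = "prd C (one C) (one C)"
  have pS: "pnt S = zero_arr C (one C) (car S)"
    by (rule from_one_unique[of _ "car S"]) (simp_all add: hom_def)
  have "dop S \<cdot> prod_arr C (pnt S) (pnt S) = zero_arr C ?q (car S)"
    using hyper_slominski_ops(3)[OF P_imp[OF P], of "zero_arr C ?q (car S)" "zero_arr C ?q (car S)"]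
    by (simp add: pS prod_arr_def)
  then have "pnt S \<cdot> dop trivial_setting = dop S \<cdot> prod_arr C (pnt S) (pnt S)"
    by (simp add: pS)
  then have "(trivial_setting, pnt S, S) \<in> hom (settings C P) trivial_setting S"
    by (simp add: hom_def settings_arr P P_trivial)
  moreover have "a = (trivial_setting, pnt S, S)"
    if "a \<in> hom (settings C P) trivial_setting S" for a
    using that from_one_unique[of _ "car S" "pnt S"]
    by (cases a) (auto simp: hom_def settings_arr)
  ultimately show "\<exists>!f. f \<in> hom (settings C P) trivial_setting S" by blast
qed

text \<open>A factorization through the trivial setting has an underlying factorization through
  \<open>one C\<close>, and any factorization through a zero object computes the zero arrow.\<close>

lemma zero_arr_settings:
  assumes "P S" "P S'"
  shows "zero_arr (settings C P) S S' = (S, zero_arr C (car S) (car S'), S')"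
proof -
  have "S \<in> Obj (settings C P)" "S' \<in> Obj (settings C P)" using assms by auto
  then obtain j i where ji: "j \<in> hom (settings C P) S trivial_setting"
    "i \<in> hom (settings C P) trivial_setting S'"
    using category.zero_obj_ex1[OF category_settings zero_obj_settings] by fast
  obtain j' i' where eq: "j = (S, j', trivial_setting)" "i = (trivial_setting, i', S')"
    using ji by (cases j, cases i) (auto simp: hom_def)
  have "j' \<in> hom C (car S) (one C)" "i' \<in> hom C (one C) (car S')"
    using ji eq by (auto simp: hom_def settings_arr trivial_setting_def)
  from zero_arr_eq[OF zero_obj this] category.zero_arr_eq[OF category_settings zero_obj_settings ji]
  show ?thesis by (simp add: eq)
qed

text \<open>An arrow \<open>h\<close> of settings killed by \<open>f\<close> factors uniquely
  through \<open>k\<close> in \<open>C\<close>. The factor preserves \<open>d\<close>: this can be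
  tested after composing with the monic \<open>k\<close>, and both \<open>k\<close> and
  \<open>h\<close> preserve \<open>d\<close>.\<close>

lemma kernel_settings:
  assumes f: "(X, f, Y) \<in> Arr (settings C P)" and k: "(K, k, X) \<in> Arr (settings C P)"
    and ker: "is_kernel C f k"
  shows "is_kernel (settings C P) (X, f, Y) (K, k, X)"
proof -
  have P: "P X" "P Y" "P K" using f k by (auto simp: settings_arr)
  note [simp] = hyper_slominskiD[OF P_imp[OF P(1)]] hyper_slominskiD[OF P_imp[OF P(3)]]
  have [simp]: "f \<in> Arr C" "Dom C f = car X" "Cod C f = car Y"
    "k \<in> Arr C" "Dom C k = car K" "Cod C k = car X"
    and kd: "k \<cdot> dop K = dop X \<cdot> prod_arr C k k"
    using f k by (auto simp: settings_arr hom_def)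
  have "\<exists>!g. g \<in> hom (settings C P) S K \<and> Comp (settings C P) (K, k, X) g = (S, h, X)"
    if h: "(S, h, X) \<in> Arr (settings C P)" and z: "f \<cdot> h = zero_arr C (car S) (car Y)" for S h
  proof -
    have PS: "P S" using h by (simp add: settings_arr)
    note [simp] = hyper_slominskiD[OF P_imp[OF PS]]
    have [simp]: "h \<in> Arr C" "Dom C h = car S" "Cod C h = car X"
      and hd: "h \<cdot> dop S = dop X \<cdot> prod_arr C h h"
      using h by (auto simp: settings_arr hom_def)
    obtain g where g: "g \<in> hom C (car S) (car K)" and kg: "k \<cdot> g = h"
      using kernel_ex1[OF ker, of h "car S"] z by auto
    have [simp]: "g \<in> Arr C" "Dom C g = car S" "Cod C g = car K"
      using g by (auto simp: hom_def)
    have "g \<cdot> dop S = dop K \<cdot> prod_arr C g g"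
    proof (rule kernel_mono[OF ker, of _ "prd C (car S) (car S)"])
      have "k \<cdot> (g \<cdot> dop S) = (k \<cdot> g) \<cdot> dop S" by simp
      also have "\<dots> = dop X \<cdot> prod_arr C h h" by (simp only: kg hd)
      also have "\<dots> = dop X \<cdot> prod_arr C k k \<cdot> prod_arr C g g"
        by (simp add: prod_arr_def flip: kg)
      also have "\<dots> = k \<cdot> (dop K \<cdot> prod_arr C g g)"
        unfolding kd[symmetric] by simp
      finally show "k \<cdot> (g \<cdot> dop S) = k \<cdot> (dop K \<cdot> prod_arr C g g)" .
    qed (simp_all add: hom_def)
    then have ex: "(S, g, K) \<in> hom (settings C P) S K"
      using g P PS by (simp add: hom_def settings_arr)
    have unique: "a = (S, g, K)"
      if a: "a \<in> hom (settings C P) S K" "Comp (settings C P) (K, k, X) a = (S, h, X)" for a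
    proof -
      obtain g' where a': "a = (S, g', K)" using a by (cases a) (auto simp: hom_def)
      then have "g' \<in> hom C (car S) (car K)" "k \<cdot> g' = k \<cdot> g"
        using a by (auto simp: hom_def settings_arr kg)
      then show ?thesis using kernel_mono[OF ker, of g' "car S" g] g a' by simp
    qed
    show ?thesis
      by (rule ex1I[of _ "(S, g, K)"]) (use ex kg in simp, use unique in blast)
  qed
  note ex1 = this
  show ?thesis
    unfolding is_kernel_def
  proof (intro conjI ballI impI)
    show "Comp (settings C P) (X, f, Y) (K, k, X) = zero_arr (settings C P)
        (Dom (settings C P) (K, k, X)) (Cod (settings C P) (X, f, Y))"
      using ker P by (simp add: is_kernel_def zero_arr_settings)
    fix a assume a: "a \<in> Arr (settings C P)"
      "Cod (settings C P) a = Dom (settings C P) (X, f, Y) \<and>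
        Comp (settings C P) (X, f, Y) a = zero_arr (settings C P)
          (Dom (settings C P) a) (Cod (settings C P) (X, f, Y))"
    then obtain S h where ah: "a = (S, h, X)" by (cases a) simp
    then have "P S" using a by (simp add: settings_arr)
    with a ah P have "(S, h, X) \<in> Arr (settings C P)" "f \<cdot> h = zero_arr C (car S) (car Y)"
      by (simp_all add: zero_arr_settings)
    from ex1[OF this] show "\<exists>!g. g \<in> hom (settings C P) (Dom (settings C P) a)
        (Dom (settings C P) (K, k, X)) \<and> Comp (settings C P) (K, k, X) g = a"
      by (simp only: ah settings_simps)
  qed (simp_all add: k)
qed

end

text \<open>Here \<open>Q\<close> is any product of \<open>A\<close> with itself, since a functor
  need not preserve the chosen one. Think of \<open>\<theta>\<close> as sending
  \<open>(x, z)\<close> to \<open>(z, j d(x, z))\<close>: its inverse solves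
  \<open>d(x, z) = y\<close> for \<open>x\<close>, which gives \<circ>, and its value on the
  diagonal \<open>\<delta>\<close> gives \<open>d(x, x) = 1\<close>.\<close>

lemma (in pointed_category) hyper_slominski_exists:
  assumes P: "is_product C A A Q p q"
    and K: "K \<in> Obj C" and \<theta>: "iso_arr C \<theta>" "\<theta> \<in> hom C Q (prd C A K)"
    and \<theta>q: "pr1 C A K \<cdot> \<theta> = q"
    and e: "e \<in> hom C K A" and j: "j \<in> hom C A K" and ej: "e \<cdot> j = Idt C A" "j \<cdot> e = Idt C K"
    and \<delta>: "\<delta> \<in> hom C A Q" "p \<cdot> \<delta> = Idt C A" "q \<cdot> \<delta> = Idt C A"
    and \<theta>\<delta>: "pr2 C A K \<cdot> (\<theta> \<cdot> \<delta>) = zero_arr C A K"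
  shows "\<exists>S. hyper_slominski C S \<and> car S = A \<and> dop S \<cdot> tuple C p q = e \<cdot> (pr2 C A K \<cdot> \<theta>)"
proof -
  have [simp]: "A \<in> Obj C" "K \<in> Obj C" using e hom_obj by auto
  have [simp]: "\<theta> \<in> Arr C" "Dom C \<theta> = Q" "Cod C \<theta> = prd C A K"
    "e \<in> Arr C" "Dom C e = K" "Cod C e = A" "j \<in> Arr C" "Dom C j = A" "Cod C j = K"
    "\<delta> \<in> Arr C" "Dom C \<delta> = A" "Cod C \<delta> = Q"
    "p \<in> Arr C" "Dom C p = Q" "Cod C p = A" "q \<in> Arr C" "Dom C q = Q" "Cod C q = A"
    using \<theta>(2) e j \<delta>(1) P by (auto simp: hom_def is_product_def)
  have Q: "Q \<in> Obj C" using dom_cod_obj(2)[of \<delta>] by simp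
  obtain \<theta>' where \<theta>': "\<theta>' \<in> hom C (prd C A K) Q" "\<theta>' \<cdot> \<theta> = Idt C Q" "\<theta> \<cdot> \<theta>' = Idt C (prd C A K)"
    using \<theta>(1) unfolding iso_arr_def by auto
  have [simp]: "\<theta>' \<in> Arr C" "Dom C \<theta>' = prd C A K" "Cod C \<theta>' = Q"
    using \<theta>'(1) by (auto simp: hom_def)
  have q\<theta>': "q \<cdot> \<theta>' = pr1 C A K"
    using \<theta>'(3) by (simp flip: \<theta>q)
  have P_ex: "\<exists>w. w \<in> hom C T Q \<and> p \<cdot> w = x \<and> q \<cdot> w = z"
    if "x \<in> hom C T A" "z \<in> hom C T A" for T x z
    using product_ex1[OF P that] by auto
  have P_unique: "w = w'" if "w \<in> hom C T Q" "w' \<in> hom C T Q" "p \<cdot> w = p \<cdot> w'" "q \<cdot> w = q \<cdot> w'" for T w w'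
  proof -
    have "p \<cdot> w \<in> hom C T A" "q \<cdot> w \<in> hom C T A"
      using that by (auto simp: hom_def)
    then have "\<exists>!v. v \<in> hom C T Q \<and> p \<cdot> v = p \<cdot> w \<and> q \<cdot> v = q \<cdot> w"
      by (rule product_ex1[OF P])
    then show ?thesis using that by metis
  qed
  \<comment> \<open>The comparison from the chosen product, on which the operations of a setting
    live, to \<open>Q\<close>.\<close>
  obtain m where m: "m \<in> hom C (prd C A A) Q" "p \<cdot> m = pr1 C A A" "q \<cdot> m = pr2 C A A"
    using P_ex[of "pr1 C A A" "prd C A A" "pr2 C A A"] by (auto simp: hom_def)
  have [simp]: "m \<in> Arr C" "Dom C m = prd C A A" "Cod C m = Q" using m(1) by (auto simp: hom_def)
  have m_tuple: "m \<cdot> tuple C x z = w"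
    if w: "w \<in> hom C T Q" "p \<cdot> w = x" "q \<cdot> w = z" for T w x z
  proof (rule P_unique)
    have [simp]: "x \<in> Arr C" "z \<in> Arr C" "Dom C x = T" "Dom C z = T" "Cod C x = A" "Cod C z = A"
      using w by (auto simp: hom_def)
    show "m \<cdot> tuple C x z \<in> hom C T Q" by (simp add: hom_def)
    have "p \<cdot> (m \<cdot> tuple C x z) = (p \<cdot> m) \<cdot> tuple C x z" by simp
    then show "p \<cdot> (m \<cdot> tuple C x z) = p \<cdot> w" unfolding m w(2) by simp
    have "q \<cdot> (m \<cdot> tuple C x z) = (q \<cdot> m) \<cdot> tuple C x z" by simp
    then show "q \<cdot> (m \<cdot> tuple C x z) = q \<cdot> w" unfolding m w(3) by simp
  qed (rule w)
  define d where "d = e \<cdot> (pr2 C A K \<cdot> (\<theta> \<cdot> m))"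
  \<comment> \<open>Given \<open>x\<close> and \<open>z\<close>, \<open>\<theta>'\<close> returns
    the pair in \<open>Q\<close> with second coordinate \<open>x\<close> and difference
    \<open>z\<close>; its first coordinate is \<open>x \<circ> z\<close>.\<close>
  define c where "c = p \<cdot> (\<theta>' \<cdot> tuple C (pr1 C A A) (j \<cdot> pr2 C A A))"
  obtain i where i: "i \<in> hom C (one C) A" using from_one_exists[of A] by auto
  have [simp]: "d \<in> Arr C" "Dom C d = prd C A A" "Cod C d = A"
    "c \<in> Arr C" "Dom C c = prd C A A" "Cod C c = A"
    by (simp_all add: d_def c_def)
  have d_eq: "d \<cdot> tuple C x z = e \<cdot> (pr2 C A K \<cdot> (\<theta> \<cdot> w))"
    if w: "w \<in> hom C T Q" "p \<cdot> w = x" "q \<cdot> w = z" for T w x z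
  proof -
    have "x \<in> Arr C" "z \<in> Arr C" "Dom C x = T" "Dom C z = T" "Cod C x = A" "Cod C z = A"
      using w by (auto simp: hom_def)
    then show ?thesis using m_tuple[OF w] by (simp add: d_def)
  qed
  have c_eq: "c \<cdot> tuple C x z = p \<cdot> (\<theta>' \<cdot> tuple C x (j \<cdot> z))"
    if "x \<in> hom C T A" "z \<in> hom C T A" for T x z
    using that by (simp add: c_def hom_def)
  have "d \<cdot> tuple C (c \<cdot> tuple C x z) x = z"
    if "T \<in> Obj C" "x \<in> hom C T A" "z \<in> hom C T A" for T x z
  proof -
    have [simp]: "x \<in> Arr C" "z \<in> Arr C" "Dom C x = T" "Dom C z = T" "Cod C x = A" "Cod C z = A"
      using that by (auto simp: hom_def)
    let ?w = "\<theta>' \<cdot> tuple C x (j \<cdot> z)"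
    have "q \<cdot> ?w = (q \<cdot> \<theta>') \<cdot> tuple C x (j \<cdot> z)" by simp
    then have "q \<cdot> ?w = x" unfolding q\<theta>' by simp
    then have "d \<cdot> tuple C (p \<cdot> ?w) x = e \<cdot> (pr2 C A K \<cdot> (\<theta> \<cdot> ?w))"
      by (intro d_eq[of _ T]) (simp_all add: hom_def)
    also have "\<theta> \<cdot> ?w = (\<theta> \<cdot> \<theta>') \<cdot> tuple C x (j \<cdot> z)" by simp
    also have "e \<cdot> (pr2 C A K \<cdot> \<dots>) = (e \<cdot> j) \<cdot> z" unfolding \<theta>' by simp
    also have "\<dots> = z" unfolding ej by simp
    finally show ?thesis using c_eq that by simp
  qed
  moreover have "c \<cdot> tuple C x (d \<cdot> tuple C z x) = z"
    if "T \<in> Obj C" and xz: "x \<in> hom C T A" "z \<in> hom C T A" for T x z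
  proof -
    have [simp]: "x \<in> Arr C" "z \<in> Arr C" "Dom C x = T" "Dom C z = T" "Cod C x = A" "Cod C z = A"
      using xz by (auto simp: hom_def)
    \<comment> \<open>\<open>w\<close> is the pair \<open>(z, x)\<close>. Then
      \<open>\<theta> w = (x, j d(z, x))\<close>, so \<open>\<theta>'\<close> gives \<open>w\<close>
      back, with first coordinate \<open>z\<close>.\<close>
    obtain w where w: "w \<in> hom C T Q" "p \<cdot> w = z" "q \<cdot> w = x" using P_ex[OF xz(2,1)] by auto
    have [simp]: "w \<in> Arr C" "Dom C w = T" "Cod C w = Q" using w(1) by (auto simp: hom_def)
    have "c \<cdot> tuple C x (d \<cdot> tuple C z x) = p \<cdot> (\<theta>' \<cdot> tuple C x (j \<cdot> (d \<cdot> tuple C z x)))"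
      using that by (intro c_eq) (simp_all add: hom_def)
    also have "j \<cdot> (d \<cdot> tuple C z x) = (j \<cdot> e) \<cdot> (pr2 C A K \<cdot> (\<theta> \<cdot> w))"
      by (simp add: d_eq[OF w])
    also have "\<dots> = pr2 C A K \<cdot> (\<theta> \<cdot> w)" unfolding ej by simp
    also have "tuple C x \<dots> = tuple C (pr1 C A K \<cdot> (\<theta> \<cdot> w)) (pr2 C A K \<cdot> (\<theta> \<cdot> w))"
      using w(3) by (simp flip: \<theta>q)
    also have "\<dots> = \<theta> \<cdot> w" by (rule tuple_eta) (simp_all add: hom_def)
    also have "\<theta>' \<cdot> (\<theta> \<cdot> w) = (\<theta>' \<cdot> \<theta>) \<cdot> w" by simp
    also have "\<dots> = w" unfolding \<theta>' by simp
    finally show ?thesis using w by simp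
  qed
  moreover have "d \<cdot> tuple C x x = i \<cdot> to_one C T"
    if "T \<in> Obj C" "x \<in> hom C T A" for T x
  proof -
    have [simp]: "x \<in> Arr C" "Dom C x = T" "Cod C x = A"
      using that by (auto simp: hom_def)
    \<comment> \<open>\<open>\<delta> x\<close> is the pair \<open>(x, x)\<close> in
      \<open>Q\<close>.\<close>
    have "p \<cdot> (\<delta> \<cdot> x) = (p \<cdot> \<delta>) \<cdot> x" "q \<cdot> (\<delta> \<cdot> x) = (q \<cdot> \<delta>) \<cdot> x" by simp_all
    then have "p \<cdot> (\<delta> \<cdot> x) = x" "q \<cdot> (\<delta> \<cdot> x) = x" unfolding \<delta> by simp_all
    then have "d \<cdot> tuple C x x = e \<cdot> (pr2 C A K \<cdot> (\<theta> \<cdot> (\<delta> \<cdot> x)))"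
      by (intro d_eq[of _ T]) (simp_all add: hom_def)
    also have "\<dots> = e \<cdot> ((pr2 C A K \<cdot> (\<theta> \<cdot> \<delta>)) \<cdot> x)" by simp
    also have "\<dots> = zero_arr C T A" unfolding \<theta>\<delta> by (simp add: that)
    finally show ?thesis using zero_arr_via_one[OF i that(1)] by simp
  qed
  ultimately have "hyper_slominski C \<lparr>car = A, dop = d, cop = c, pnt = i\<rparr>"
    using i by (simp add: hyper_slominski_def hom_def)
  \<comment> \<open>\<open>p\<close> and \<open>q\<close> are the coordinates of the identity of
    \<open>Q\<close>.\<close>
  moreover have "d \<cdot> tuple C p q = e \<cdot> (pr2 C A K \<cdot> \<theta>)"
    using Q by (subst d_eq[of "Idt C Q" Q]) (simp_all add: hom_def)
  ultimately show ?thesis by (intro exI[of _ "\<lparr>car = A, dop = d, cop = c, pnt = i\<rparr>"]) simp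
qed

section \<open>Left exact functors\<close>

text \<open>The three index categories give the terminal object, binary products, and kernels as
  equalizers with a zero arrow. Of two composable arrows in them one is an identity, and
  \<open>Comp\<close> returns the other.\<close>

definition empty_category :: "(nat, nat) category" where
  "empty_category = \<lparr>Obj = {}, Arr = {}, Dom = id, Cod = id, Idt = id, Comp = (\<lambda>g f. f)\<rparr>"

definition discrete_pair :: "(nat, nat) category" where
  "discrete_pair = \<lparr>Obj = {0, 1}, Arr = {0, 1}, Dom = id, Cod = id, Idt = id, Comp = (\<lambda>g f. f)\<rparr>"

text \<open>The arrows \<open>0\<close> and \<open>1\<close> are the identities, and \<open>2\<close> and \<open>3\<close> go from \<open>0\<close> to \<open>1\<close>.\<close>

definition parallel_pair :: "(nat, nat) category" where
  "parallel_pair = \<lparr>Obj = {0, 1}, Arr = {0, 1, 2, 3}, Dom = (\<lambda>u. if u = 1 then 1 else 0),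
     Cod = (\<lambda>u. if u = 0 then 0 else 1), Idt = id, Comp = (\<lambda>g f. if g < 2 then f else g)\<rparr>"

lemma finite_category_empty: "finite_category empty_category"
  by (auto simp: finite_category_def category_def empty_category_def)

lemma finite_category_discrete_pair: "finite_category discrete_pair"
  by (auto simp: finite_category_def category_def discrete_pair_def hom_def)

lemma finite_category_parallel_pair: "finite_category parallel_pair"
  by (auto simp: finite_category_def category_def parallel_pair_def hom_def)

text \<open>The only arrows of the index category are identities, so a cone is just a pair of
  legs.\<close>

lemma (in category) product_iff_limit:
  assumes F: "is_functor discrete_pair C F"
  shows "is_limit C discrete_pair F L \<pi> \<longleftrightarrow> is_product C (FO F 0) (FO F 1) L (\<pi> 0) (\<pi> 1)"
proof -
  have [simp]: "FA F 0 = Idt C (FO F 0)" "FA F (Suc 0) = Idt C (FO F (Suc 0))"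
    using F by (auto simp: is_functor_def discrete_pair_def)
  have cone: "is_cone C discrete_pair F A \<tau> \<longleftrightarrow> \<tau> 0 \<in> hom C A (FO F 0) \<and> \<tau> 1 \<in> hom C A (FO F 1)"
    for A \<tau>
    by (auto simp: is_cone_def discrete_pair_def hom_def)
  have obj: "(\<forall>j \<in> Obj discrete_pair. Q j) \<longleftrightarrow> Q 0 \<and> Q 1" for Q
    by (simp add: discrete_pair_def)
  show ?thesis
  proof
    assume lim: "is_limit C discrete_pair F L \<pi>"
    show "is_product C (FO F 0) (FO F 1) L (\<pi> 0) (\<pi> 1)"
      unfolding is_product_def
    proof (intro conjI ballI)
      show "\<pi> 0 \<in> hom C L (FO F 0)" "\<pi> 1 \<in> hom C L (FO F 1)"
        using lim by (simp_all add: is_limit_def cone)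
      fix T f g assume "f \<in> hom C T (FO F 0)" "g \<in> hom C T (FO F 1)"
      then have "is_cone C discrete_pair F T (\<lambda>j. if j = 0 then f else g)"
        by (simp add: cone)
      with lim have "\<exists>!h. h \<in> hom C T L \<and>
          (\<forall>j \<in> Obj discrete_pair. \<pi> j \<cdot> h = (if j = 0 then f else g))"
        unfolding is_limit_def by (elim conjE allE impE)
      then show "\<exists>!h. h \<in> hom C T L \<and> \<pi> 0 \<cdot> h = f \<and> \<pi> 1 \<cdot> h = g"
        by (simp add: obj)
    qed
  next
    assume prod: "is_product C (FO F 0) (FO F 1) L (\<pi> 0) (\<pi> 1)"
    show "is_limit C discrete_pair F L \<pi>"
      unfolding is_limit_def obj
    proof (intro conjI allI impI)
      show "is_cone C discrete_pair F L \<pi>"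
        using prod by (simp add: cone is_product_def)
      fix A \<tau> assume "is_cone C discrete_pair F A \<tau>"
      then show "\<exists>!h. h \<in> hom C A L \<and> \<pi> 0 \<cdot> h = \<tau> 0 \<and> \<pi> 1 \<cdot> h = \<tau> 1"
        by (intro product_ex1[OF prod]) (simp_all add: cone)
    qed
  qed
qed

text \<open>The kernel of \<open>FA F 2\<close> is its equalizer with the zero arrow
  \<open>FA F 3\<close>. Arrow 3 forces the leg of a cone at 1 to be zero; a kernel says nothing
  about that leg, so \<open>\<pi> 1\<close> is fixed by assumption.\<close>

lemma (in pointed_category) kernel_iff_limit:
  assumes F: "is_functor parallel_pair C F" and zero: "FA F 3 = zero_arr C (FO F 0) (FO F 1)"
    and \<pi>1: "\<pi> 1 = zero_arr C L (FO F 1)"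
  shows "is_limit C parallel_pair F L \<pi> \<longleftrightarrow> is_kernel C (FA F 2) (\<pi> 0) \<and> Dom C (\<pi> 0) = L"
proof -
  have [simp]: "FA F 0 = Idt C (FO F 0)" "FA F (Suc 0) = Idt C (FO F (Suc 0))"
    "FA F 2 \<in> Arr C" "Dom C (FA F 2) = FO F 0" "Cod C (FA F 2) = FO F (Suc 0)"
    "FO F 0 \<in> Obj C" "FO F (Suc 0) \<in> Obj C"
    using F by (auto simp: is_functor_def parallel_pair_def hom_def)
  have cone: "is_cone C parallel_pair F A \<tau> \<longleftrightarrow> \<tau> 0 \<in> hom C A (FO F 0) \<and>
      \<tau> 1 = zero_arr C A (FO F 1) \<and> FA F 2 \<cdot> \<tau> 0 = zero_arr C A (FO F 1)" for A \<tau>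
    by (auto simp: is_cone_def parallel_pair_def hom_def zero)
  have obj: "(\<forall>j \<in> Obj parallel_pair. Q j) \<longleftrightarrow> Q 0 \<and> Q 1" for Q
    by (simp add: parallel_pair_def)
  have \<pi>1_comp: "\<pi> 1 \<cdot> h = zero_arr C A (FO F 1)" if "h \<in> hom C A L" for A h
    using that hom_obj(2)[OF that] unfolding \<pi>1 by (simp add: hom_def)
  show ?thesis
  proof
    assume lim: "is_limit C parallel_pair F L \<pi>"
    then have \<pi>0: "\<pi> 0 \<in> Arr C" "Dom C (\<pi> 0) = L" "Cod C (\<pi> 0) = FO F 0"
      "FA F 2 \<cdot> \<pi> 0 = zero_arr C L (FO F 1)"
      by (simp_all add: is_limit_def cone hom_def)
    have "is_kernel C (FA F 2) (\<pi> 0)"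
      unfolding is_kernel_def
    proof (intro conjI ballI impI)
      fix h assume h: "h \<in> Arr C" "Cod C h = Dom C (FA F 2) \<and>
        FA F 2 \<cdot> h = zero_arr C (Dom C h) (Cod C (FA F 2))"
      then have "is_cone C parallel_pair F (Dom C h)
          (\<lambda>j. if j = 0 then h else zero_arr C (Dom C h) (FO F 1))"
        by (simp add: cone hom_def)
      with lim have "\<exists>!g. g \<in> hom C (Dom C h) L \<and> (\<forall>j \<in> Obj parallel_pair.
          \<pi> j \<cdot> g = (if j = 0 then h else zero_arr C (Dom C h) (FO F 1)))"
        unfolding is_limit_def by (elim conjE allE impE)
      \<comment> \<open>The equation at index 1 holds for every \<open>g\<close> by
        \<open>\<pi>1_comp\<close> and drops out.\<close>
      then have "\<exists>!g. g \<in> hom C (Dom C h) L \<and> \<pi> 0 \<cdot> g = h"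
        using \<pi>1_comp[of _ "Dom C h"] by (simp add: obj cong: conj_cong)
      then show "\<exists>!g. g \<in> hom C (Dom C h) (Dom C (\<pi> 0)) \<and> \<pi> 0 \<cdot> g = h"
        by (simp only: \<pi>0)
    qed (simp_all add: \<pi>0)
    then show "is_kernel C (FA F 2) (\<pi> 0) \<and> Dom C (\<pi> 0) = L"
      using \<pi>0 by simp
  next
    assume ker: "is_kernel C (FA F 2) (\<pi> 0) \<and> Dom C (\<pi> 0) = L"
    show "is_limit C parallel_pair F L \<pi>"
      unfolding is_limit_def obj
    proof (intro conjI allI impI)
      show "is_cone C parallel_pair F L \<pi>"
        using ker \<pi>1 by (simp add: cone is_kernel_def hom_def)
      fix A \<tau> assume \<tau>: "is_cone C parallel_pair F A \<tau>"
      have "\<exists>!h. h \<in> hom C A (Dom C (\<pi> 0)) \<and> \<pi> 0 \<cdot> h = \<tau> 0"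
        by (rule kernel_ex1[of "FA F 2"]) (use \<tau> ker in \<open>simp_all add: cone hom_def\<close>)
      then show "\<exists>!h. h \<in> hom C A L \<and> \<pi> 0 \<cdot> h = \<tau> 0 \<and> \<pi> 1 \<cdot> h = \<tau> 1"
        using \<tau> ker \<pi>1_comp[of _ A] by (simp add: cone cong: conj_cong)
    qed
  qed
qed

section \<open>Preservation of zero arrows, products and kernels by left exact functors\<close>

locale left_exact_functor = C: pointed_category C + D: pointed_category D
  for C :: "('o, 'a) chosen_category" and D :: "('p, 'b) chosen_category" +
  fixes U :: "('o, 'a, 'p, 'b) cat_functor"
  assumes left_exact: "left_exact C D U"
begin

lemma is_functor: "is_functor C D U"
  using left_exact by (simp add: left_exact_def)

lemma functor_simps [simp]:
  "A \<in> Obj C \<Longrightarrow> FO U A \<in> Obj D"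
  "f \<in> Arr C \<Longrightarrow> FA U f \<in> Arr D"
  "f \<in> Arr C \<Longrightarrow> Dom D (FA U f) = FO U (Dom C f)"
  "f \<in> Arr C \<Longrightarrow> Cod D (FA U f) = FO U (Cod C f)"
  "A \<in> Obj C \<Longrightarrow> FA U (Idt C A) = Idt D (FO U A)"
  "f \<in> Arr C \<Longrightarrow> g \<in> Arr C \<Longrightarrow> Dom C g = Cod C f \<Longrightarrow> FA U (g \<cdot>\<^bsub>C\<^esub> f) = FA U g \<cdot>\<^bsub>D\<^esub> FA U f"
  using is_functor by (auto simp: is_functor_def hom_def)

lemma functor_comp_functor:
  assumes "is_functor J C F" shows "is_functor J D (functor_comp U F)"
  using assms is_functor by (auto simp: is_functor_def functor_comp_def hom_def)

lemma preserves_limit: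
  assumes "finite_category J" "is_functor J C F" "is_limit C J F L \<pi>"
  shows "is_limit D J (functor_comp U F) (FO U L) (\<lambda>j. FA U (\<pi> j))"
  using left_exact assms unfolding left_exact_def by blast

text \<open>The zero object is terminal, hence a limit of the empty diagram, so its image is
  terminal in \<open>D\<close>.\<close>

lemma one_image_terminal:
  assumes "f \<in> hom D A (FO U (one C))" "g \<in> hom D A (FO U (one C))"
  shows "f = g"
proof -
  obtain F :: "(nat, nat, 'o, 'a) cat_functor" where F: "is_functor empty_category C F"
    using finite_category_empty C.category_axioms
    by (auto simp: is_functor_def finite_category_def empty_category_def)
  have "is_limit C empty_category F (one C) \<pi>" for \<pi>
    using C.zero_obj_ex1(1)[OF C.zero_obj]
    by (simp add: is_limit_def is_cone_def empty_category_def)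
  from preserves_limit[OF finite_category_empty F this]
  have "A \<in> Obj D \<Longrightarrow> \<exists>!h. h \<in> hom D A (FO U (one C))" for A
    by (simp add: is_limit_def is_cone_def empty_category_def)
  from this[OF D.hom_obj(1)[OF assms(1)]] assms show ?thesis by auto
qed

text \<open>A zero arrow starts with \<open>to_one C A\<close>, whose image ends in the terminal
  object \<open>FO U (one C)\<close> and so must be a zero arrow.\<close>

lemma zero_arr_image [simp]:
  assumes "A \<in> Obj C" "B \<in> Obj C"
  shows "FA U (zero_arr C A B) = zero_arr D (FO U A) (FO U B)"
proof -
  obtain i where i: "i \<in> hom C (one C) B" using C.from_one_exists assms(2) by auto
  have "FA U (to_one C A) = zero_arr D (FO U A) (FO U (one C))"
    by (rule one_image_terminal[of _ "FO U A"]) (use assms in \<open>simp_all add: hom_def\<close>)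
  then show ?thesis
    using i assms by (simp add: C.zero_arr_via_one[OF i] hom_def)
qed

text \<open>The image is a product in \<open>D\<close> but in general not the chosen one, which is
  why later proofs move between \<open>FO U (prd C X X)\<close> and the chosen product.\<close>

lemma product_image:
  assumes "is_product C A B Q p q" "A \<in> Obj C" "B \<in> Obj C"
  shows "is_product D (FO U A) (FO U B) (FO U Q) (FA U p) (FA U q)"
proof -
  define F :: "(nat, nat, 'o, 'a) cat_functor" where
    "F = \<lparr>FO = (\<lambda>j. if j = 0 then A else B), FA = (\<lambda>j. Idt C (if j = 0 then A else B))\<rparr>"
  define \<pi> where "\<pi> j = (if j = 0 then p else q)" for j :: nat
  have F: "is_functor discrete_pair C F"
    using finite_category_discrete_pair C.category_axioms assms(2,3)
    by (auto simp: is_functor_def finite_category_def discrete_pair_def F_def hom_def)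
  have "is_limit C discrete_pair F Q \<pi>"
    unfolding C.product_iff_limit[OF F] using assms(1) by (simp add: F_def \<pi>_def)
  from preserves_limit[OF finite_category_discrete_pair F this] show ?thesis
    unfolding D.product_iff_limit[OF functor_comp_functor[OF F]]
    by (simp add: functor_comp_def F_def \<pi>_def)
qed

lemma kernel_image:
  assumes k: "is_kernel C f k" and f: "f \<in> Arr C"
  shows "is_kernel D (FA U f) (FA U k)"
proof -
  let ?A = "Dom C f" and ?B = "Cod C f"
  define F :: "(nat, nat, 'o, 'a) cat_functor" where
    "F = \<lparr>FO = (\<lambda>j. if j = 0 then ?A else ?B),
      FA = (\<lambda>u. if u = 0 then Idt C ?A else if u = 1 then Idt C ?B
                else if u = 2 then f else zero_arr C ?A ?B)\<rparr>"
  define \<pi> where "\<pi> j = (if j = 0 then k else zero_arr C (Dom C k) ?B)" for j :: nat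
  have [simp]: "k \<in> Arr C" using k by (simp add: is_kernel_def)
  have F: "is_functor parallel_pair C F"
    unfolding is_functor_def
  proof (intro conjI)
    show "category parallel_pair" "category C"
      using finite_category_parallel_pair C.category_axioms by (simp_all add: finite_category_def)
    show "\<forall>A \<in> Obj parallel_pair. FO F A \<in> Obj C"
      using f by (simp add: parallel_pair_def F_def)
    have F_simps: "FO F 0 = ?A" "FO F 1 = ?B" "FA F 0 = Idt C ?A" "FA F 1 = Idt C ?B"
      "FA F 2 = f" "FA F 3 = zero_arr C ?A ?B"
      by (simp_all add: F_def)
    show "\<forall>u \<in> Arr parallel_pair. FA F u \<in>
        hom C (FO F (Dom parallel_pair u)) (FO F (Cod parallel_pair u))"
      using f by (simp add: parallel_pair_def F_simps hom_def flip: One_nat_def)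
    show "\<forall>A \<in> Obj parallel_pair. FA F (Idt parallel_pair A) = Idt C (FO F A)"
      using f by (simp add: parallel_pair_def F_simps flip: One_nat_def)
    show "\<forall>u \<in> Arr parallel_pair. \<forall>v \<in> Arr parallel_pair. Dom parallel_pair v = Cod parallel_pair u
        \<longrightarrow> FA F (Comp parallel_pair v u) = FA F v \<cdot>\<^bsub>C\<^esub> FA F u"
      using f by (simp add: parallel_pair_def F_simps flip: One_nat_def)
  qed
  have "is_limit C parallel_pair F (Dom C k) \<pi>"
    by (subst C.kernel_iff_limit[OF F]) (use k in \<open>simp_all add: F_def \<pi>_def\<close>)
  \<comment> \<open>Reading the image limit as a kernel again relies on
    \<open>zero_arr_image\<close>, for the arrow 3 and for the leg at 1.\<close>
  from preserves_limit[OF finite_category_parallel_pair F this]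
  have "is_kernel D (FA (functor_comp U F) 2) (FA U (\<pi> 0))"
    by (subst (asm) D.kernel_iff_limit[OF functor_comp_functor[OF F]])
      (use f in \<open>simp_all add: functor_comp_def F_def \<pi>_def\<close>)
  then show ?thesis by (simp add: functor_comp_def F_def \<pi>_def)
qed

end

section \<open>The settings induced by a semi-direct index\<close>

locale indexed_functor = left_exact_functor +
  fixes \<rho> :: "'b pt_obj \<Rightarrow> 'd pt_arr"
  assumes index: "semi_direct_index C D U \<rho>"
begin

section \<open>Components of the index and their naturality\<close>

abbreviation index_top :: "'b \<Rightarrow> 'b \<Rightarrow> 'd" where "index_top f s \<equiv> pt_top (\<rho> (f, s))"
abbreviation gamma :: "'b \<Rightarrow> 'b \<Rightarrow> 'd" where "gamma f s \<equiv> index_gamma C D U \<rho> f s"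
abbreviation Ker :: "'b \<Rightarrow> 'a" where "Ker f \<equiv> Dom C (ker C f)"

lemma split_epiD:
  assumes "(f, s) \<in> split_epis C"
  shows "f \<in> Arr C" "s \<in> Arr C" "Dom C s = Cod C f" "Cod C s = Dom C f"
    "f \<cdot>\<^bsub>C\<^esub> s = Idt C (Cod C f)"
  using assms by (auto simp: split_epis_def hom_def)

text \<open>A component of \<rho> is an arrow of \<open>Pt D\<close> with identity base. Its square
  of epimorphisms gives the equation for \<open>pr1\<close>; its square of sections, with target
  section \<open>(Id, 0)\<close>, gives the vanishing of \<open>gamma\<close>.\<close>

lemma index_component:
  assumes fs: "(f, s) \<in> split_epis C"
  shows "\<rho> (f, s) = ((FA U f, FA U s), (index_top f s, Idt D (FO U (Cod C f))), W_obj C D U f)" (is ?eq)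
    and "index_top f s \<in> hom D (FO U (Dom C f)) (prd D (FO U (Cod C f)) (FO U (Ker f)))" (is ?hom)
    and "pr1 D (FO U (Cod C f)) (FO U (Ker f)) \<cdot>\<^bsub>D\<^esub> index_top f s = FA U f" (is ?pr)
    and "gamma f s \<cdot>\<^bsub>D\<^esub> FA U s = zero_arr D (FO U (Cod C f)) (FO U (Ker f))" (is ?zero)
    and "iso_arr D (index_top f s)"
proof -
  note [simp] = split_epiD[OF fs]
  have base: "pt_base (\<rho> (f, s)) = Idt D (FO U (Cod C f))" and "iso_arr D (index_top f s)"
    using index fs by (auto simp: semi_direct_index_def)
  then show "iso_arr D (index_top f s)" by blast
  have "\<rho> (f, s) \<in> hom (Pt D) (FO (Pt_functor U) (f, s)) (FO (W_functor C D U) (f, s))"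
    using index fs by (auto simp: semi_direct_index_def natural_iso_def Pt_def)
  then have arr: "\<rho> (f, s) \<in> Arr (Pt D)" and dom: "Dom (Pt D) (\<rho> (f, s)) = (FA U f, FA U s)"
    and cod: "Cod (Pt D) (\<rho> (f, s)) = W_obj C D U f"
    by (auto simp: hom_def Pt_functor_def W_functor_def)
  obtain p x y q where \<rho>: "\<rho> (f, s) = (p, (x, y), q)" by (metis prod_cases4 surj_pair)
  then show eq: ?eq
    using base dom cod by (simp add: pt_base_def pt_top_def Pt_def)
  have "(p, (x, y), q) = ((FA U f, FA U s), (x, y), trivial_point D (FO U (Cod C f)) (FO U (Ker f)))"
    using \<rho> eq by (simp add: W_obj_def)
  with arr \<rho> have x: "x \<in> hom D (FO U (Dom C f)) (prd D (FO U (Cod C f)) (FO U (Ker f)))"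
    "pr1 D (FO U (Cod C f)) (FO U (Ker f)) \<cdot>\<^bsub>D\<^esub> x = y \<cdot>\<^bsub>D\<^esub> FA U f"
    "x \<cdot>\<^bsub>D\<^esub> FA U s = tuple D (Idt D (FO U (Cod C f)))
      (zero_arr D (FO U (Cod C f)) (FO U (Ker f))) \<cdot>\<^bsub>D\<^esub> y"
    by (auto simp: Pt_def trivial_point_def)
  have y: "y = Idt D (FO U (Cod C f))" and x_top: "x = index_top f s"
    using \<rho> base by (simp_all add: pt_base_def pt_top_def)
  show ?hom using x x_top by simp
  then have [simp]: "index_top f s \<in> Arr D" "Dom D (index_top f s) = FO U (Dom C f)"
    "Cod D (index_top f s) = prd D (FO U (Cod C f)) (FO U (Ker f))"
    by (auto simp: hom_def)
  show ?pr using x(2) by (simp add: y x_top)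
  show ?zero using x(3) by (simp add: index_gamma_def y x_top)
qed

lemma gamma_arr [simp]:
  assumes "(f, s) \<in> split_epis C"
  shows "gamma f s \<in> Arr D" "Dom D (gamma f s) = FO U (Dom C f)" "Cod D (gamma f s) = FO U (Ker f)"
  using index_component(2)[OF assms] split_epiD[OF assms] by (auto simp: index_gamma_def hom_def)

text \<open>This is the second coordinate of the naturality square of \<rho>. The map
  \<open>h\<close> is \<open>ker_map\<close>; only its defining equation is exported, and it
  determines \<open>h\<close> since kernels are monic.\<close>

lemma gamma_natural:
  assumes fs: "(f, s) \<in> split_epis C" and fs': "(f', s') \<in> split_epis C"
    and x: "x \<in> hom C (Dom C f) (Dom C f')" and y: "y \<in> hom C (Cod C f) (Cod C f')"
    and sq: "f' \<cdot>\<^bsub>C\<^esub> x = y \<cdot>\<^bsub>C\<^esub> f" "x \<cdot>\<^bsub>C\<^esub> s = s' \<cdot>\<^bsub>C\<^esub> y"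
  obtains h where "h \<in> hom C (Ker f) (Ker f')" "ker C f' \<cdot>\<^bsub>C\<^esub> h = x \<cdot>\<^bsub>C\<^esub> ker C f"
    "gamma f' s' \<cdot>\<^bsub>D\<^esub> FA U x = FA U h \<cdot>\<^bsub>D\<^esub> gamma f s"
proof
  note [simp] = split_epiD[OF fs] split_epiD[OF fs']
  let ?h = "ker_map C f x f'"
  show h: "?h \<in> hom C (Ker f) (Ker f')" "ker C f' \<cdot>\<^bsub>C\<^esub> ?h = x \<cdot>\<^bsub>C\<^esub> ker C f"
    using C.ker_map_props[OF _ _ x y sq(1)] by simp_all
  have [simp]: "?h \<in> Arr C" "Dom C ?h = Ker f" "Cod C ?h = Ker f'"
    "x \<in> Arr C" "Dom C x = Dom C f" "Cod C x = Dom C f'"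
    "y \<in> Arr C" "Dom C y = Cod C f" "Cod C y = Cod C f'"
    using h x y by (auto simp: hom_def)
  have [simp]: "index_top f s \<in> Arr D" "Dom D (index_top f s) = FO U (Dom C f)"
    "Cod D (index_top f s) = prd D (FO U (Cod C f)) (FO U (Ker f))"
    using index_component(2)[OF fs] by (auto simp: hom_def)
  have [simp]: "index_top f' s' \<in> Arr D" "Dom D (index_top f' s') = FO U (Dom C f')"
    "Cod D (index_top f' s') = prd D (FO U (Cod C f')) (FO U (Ker f'))"
    using index_component(2)[OF fs'] by (auto simp: hom_def)
  let ?a = "((f, s), (x, y), (f', s'))"
  have "?a \<in> Arr (Pt C)" using fs fs' x y sq by (simp add: Pt_def)
  then have "Comp (Pt D) (\<rho> (Cod (Pt C) ?a)) (FA (Pt_functor U) ?a)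
      = Comp (Pt D) (FA (W_functor C D U) ?a) (\<rho> (Dom (Pt C) ?a))"
    using index unfolding semi_direct_index_def natural_iso_def by blast
  \<comment> \<open>\<open>index_top\<close> is itself written with \<rho>; naming its values keeps
    the rewriting of \<rho> by its components from looping.\<close>
  moreover obtain t t' where t: "index_top f s = t" "index_top f' s' = t'" by blast
  ultimately have "t' \<cdot>\<^bsub>D\<^esub> FA U x = prod_arr D (FA U y) (FA U ?h) \<cdot>\<^bsub>D\<^esub> t"
    by (simp add: Pt_def Pt_functor_def W_functor_def index_component(1)[OF fs, unfolded t]
        index_component(1)[OF fs', unfolded t] W_obj_def trivial_point_def)
  then have "index_top f' s' \<cdot>\<^bsub>D\<^esub> FA U x = prod_arr D (FA U y) (FA U ?h) \<cdot>\<^bsub>D\<^esub> index_top f s"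
    by (simp only: t)
  then have "pr2 D (FO U (Cod C f')) (FO U (Ker f')) \<cdot>\<^bsub>D\<^esub> (index_top f' s' \<cdot>\<^bsub>D\<^esub> FA U x)
    = pr2 D (FO U (Cod C f')) (FO U (Ker f')) \<cdot>\<^bsub>D\<^esub> (prod_arr D (FA U y) (FA U ?h) \<cdot>\<^bsub>D\<^esub> index_top f s)"
    by simp
  then show "gamma f' s' \<cdot>\<^bsub>D\<^esub> FA U x = FA U ?h \<cdot>\<^bsub>D\<^esub> gamma f s"
    by (simp add: index_gamma_def prod_arr_def)
qed

section \<open>The setting on the image of an object\<close>

abbreviation diag :: "'a \<Rightarrow> 'b" where "diag X \<equiv> tuple C (Idt C X) (Idt C X)"
abbreviation sq1 :: "'a \<Rightarrow> 'b" where "sq1 X \<equiv> pr1 C X X"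
abbreviation sq2 :: "'a \<Rightarrow> 'b" where "sq2 X \<equiv> pr2 C X X"

text \<open>In a setting, the canonical \<open>\<gamma>\<close> at the point \<open>(p\<^sub>2, \<Delta>)\<close> sends \<open>(x, y)\<close> to
  \<open>d((x, y), (y, y)) = (d(x, y), 1)\<close>, so \<open>d\<close> can be read off the index.\<close>

definition diff :: "'a \<Rightarrow> 'd" where
  "diff X = FA U (sq1 X \<cdot>\<^bsub>C\<^esub> ker C (sq2 X)) \<cdot>\<^bsub>D\<^esub> gamma (sq2 X) (diag X)"

text \<open>The last clause reads \<open>d\<close> along the comparison from
  \<open>U (X x X)\<close> to the chosen product. This comparison is invertible by
  \<open>product_image\<close>, so \<open>diff X\<close> determines \<open>dop\<close>.\<close>

definition setting_of :: "'a \<Rightarrow> ('c, 'd) setting" where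
  "setting_of X = (SOME S. hyper_slominski D S \<and> car S = FO U X \<and>
     dop S \<cdot>\<^bsub>D\<^esub> tuple D (FA U (sq1 X)) (FA U (sq2 X)) = diff X)"

definition lift :: "('a, 'b, ('c, 'd) setting, ('c, 'd) setting_arr) cat_functor" where
  "lift = \<lparr>FO = setting_of, FA = (\<lambda>f. (setting_of (Dom C f), FA U f, setting_of (Cod C f)))\<rparr>"

lemma diag_split_epi: "X \<in> Obj C \<Longrightarrow> (sq2 X, diag X) \<in> split_epis C"
  by (simp add: split_epis_def hom_def)

lemma diff_arr [simp]:
  assumes "X \<in> Obj C"
  shows "diff X \<in> Arr D" "Dom D (diff X) = FO U (prd C X X)" "Cod D (diff X) = FO U X"
  using assms diag_split_epi[OF assms] by (auto simp: diff_def)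

text \<open>The kernel of the second projection consists of the pairs \<open>(x, 1)\<close>, so it
  is a copy of \<open>X\<close>: \<open>j\<close> sends \<open>x\<close> to \<open>(x, 1)\<close>,
  and its inverse takes the first coordinate.\<close>

lemma ker_sq2:
  assumes "X \<in> Obj C"
  obtains j where "j \<in> hom C X (Ker (sq2 X))"
    "ker C (sq2 X) \<cdot>\<^bsub>C\<^esub> j = tuple C (Idt C X) (zero_arr C X X)"
    "(sq1 X \<cdot>\<^bsub>C\<^esub> ker C (sq2 X)) \<cdot>\<^bsub>C\<^esub> j = Idt C X"
    "j \<cdot>\<^bsub>C\<^esub> (sq1 X \<cdot>\<^bsub>C\<^esub> ker C (sq2 X)) = Idt C (Ker (sq2 X))"
proof -
  note [simp] = assms
  let ?k = "ker C (sq2 X)"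
  have "\<exists>!j. j \<in> hom C X (Ker (sq2 X)) \<and> ?k \<cdot>\<^bsub>C\<^esub> j = tuple C (Idt C X) (zero_arr C X X)"
    by (rule C.kernel_ex1[OF C.kernel]) simp_all
  then obtain j where j: "j \<in> hom C X (Ker (sq2 X))"
    "?k \<cdot>\<^bsub>C\<^esub> j = tuple C (Idt C X) (zero_arr C X X)"
    by (blast dest: ex1_implies_ex)
  have [simp]: "j \<in> Arr C" "Dom C j = X" "Cod C j = Ker (sq2 X)"
    using j by (auto simp: hom_def)
  have 1: "(sq1 X \<cdot>\<^bsub>C\<^esub> ?k) \<cdot>\<^bsub>C\<^esub> j = Idt C X" by (simp add: j(2))
  have "j \<cdot>\<^bsub>C\<^esub> (sq1 X \<cdot>\<^bsub>C\<^esub> ?k) = Idt C (Ker (sq2 X))"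
  proof (rule C.kernel_mono[OF C.kernel])
    have "?k \<cdot>\<^bsub>C\<^esub> (j \<cdot>\<^bsub>C\<^esub> (sq1 X \<cdot>\<^bsub>C\<^esub> ?k)) = (?k \<cdot>\<^bsub>C\<^esub> j) \<cdot>\<^bsub>C\<^esub> (sq1 X \<cdot>\<^bsub>C\<^esub> ?k)"
      by simp
    also have "\<dots> = tuple C (sq1 X \<cdot>\<^bsub>C\<^esub> ?k) (sq2 X \<cdot>\<^bsub>C\<^esub> ?k)"
      unfolding j(2) by simp
    also have "\<dots> = ?k"
      by (rule C.tuple_eta) (simp_all add: hom_def)
    finally show "?k \<cdot>\<^bsub>C\<^esub> (j \<cdot>\<^bsub>C\<^esub> (sq1 X \<cdot>\<^bsub>C\<^esub> ?k)) = ?k \<cdot>\<^bsub>C\<^esub> Idt C (Ker (sq2 X))" by simp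
  qed (simp_all add: hom_def)
  with j 1 show ?thesis by (rule that)
qed

text \<open>An instance of \<open>hyper_slominski_exists\<close> on the product
  \<open>U (X x X)\<close>: \<open>\<theta>\<close> is the component of \<rho> at
  \<open>(sq2 X, diag X)\<close>, \<open>e\<close> and \<open>j\<close> are images of the
  isomorphism in \<open>ker_sq2\<close>, and the diagonal condition is the vanishing of
  \<open>gamma\<close> on the section.\<close>

lemma setting_of:
  assumes "X \<in> Obj C"
  shows "hyper_slominski D (setting_of X)" "car (setting_of X) = FO U X"
    "dop (setting_of X) \<cdot>\<^bsub>D\<^esub> tuple D (FA U (sq1 X)) (FA U (sq2 X)) = diff X"
proof -
  note [simp] = assms
  let ?k = "ker C (sq2 X)"
  obtain j where j: "j \<in> hom C X (Ker (sq2 X))"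
    and ej: "(sq1 X \<cdot>\<^bsub>C\<^esub> ?k) \<cdot>\<^bsub>C\<^esub> j = Idt C X" "j \<cdot>\<^bsub>C\<^esub> (sq1 X \<cdot>\<^bsub>C\<^esub> ?k) = Idt C (Ker (sq2 X))"
    using ker_sq2[OF assms] by metis
  have [simp]: "j \<in> Arr C" "Dom C j = X" "Cod C j = Ker (sq2 X)"
    using j by (auto simp: hom_def)
  note pt = index_component[OF diag_split_epi[OF assms]]
  have "FA U ((sq1 X \<cdot>\<^bsub>C\<^esub> ?k) \<cdot>\<^bsub>C\<^esub> j) = Idt D (FO U X)"
    "FA U (j \<cdot>\<^bsub>C\<^esub> (sq1 X \<cdot>\<^bsub>C\<^esub> ?k)) = Idt D (FO U (Ker (sq2 X)))"
    unfolding ej by simp_all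
  moreover have "FA U (sq1 X) \<cdot>\<^bsub>D\<^esub> FA U (diag X) = Idt D (FO U X)"
    "FA U (sq2 X) \<cdot>\<^bsub>D\<^esub> FA U (diag X) = Idt D (FO U X)"
    by (simp_all flip: functor_simps(6))
  moreover have "index_top (sq2 X) (diag X) \<in> Arr D" "Dom D (index_top (sq2 X) (diag X)) = FO U (prd C X X)"
    "Cod D (index_top (sq2 X) (diag X)) = prd D (FO U X) (FO U (Ker (sq2 X)))"
    using pt(2) by (auto simp: hom_def)
  ultimately have "\<exists>S. hyper_slominski D S \<and> car S = FO U X \<and>
      dop S \<cdot>\<^bsub>D\<^esub> tuple D (FA U (sq1 X)) (FA U (sq2 X)) = FA U (sq1 X \<cdot>\<^bsub>C\<^esub> ?k) \<cdot>\<^bsub>D\<^esub>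
        (pr2 D (FO U X) (FO U (Ker (sq2 X))) \<cdot>\<^bsub>D\<^esub> index_top (sq2 X) (diag X))"
    using pt(3,4,5)
    by (intro D.hyper_slominski_exists[where j = "FA U j" and \<delta> = "FA U (diag X)"
          and Q = "FO U (prd C X X)"] product_image C.product)
      (simp_all add: hom_def index_gamma_def)
  then have "\<exists>S. hyper_slominski D S \<and> car S = FO U X \<and>
      dop S \<cdot>\<^bsub>D\<^esub> tuple D (FA U (sq1 X)) (FA U (sq2 X)) = diff X"
    by (simp only: diff_def index_gamma_def C.pr_arr assms)
  from someI_ex[OF this] show "hyper_slominski D (setting_of X)" "car (setting_of X) = FO U X"
    "dop (setting_of X) \<cdot>\<^bsub>D\<^esub> tuple D (FA U (sq1 X)) (FA U (sq2 X)) = diff X"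
    by (simp_all only: setting_of_def[symmetric])
qed

section \<open>Functoriality of the settings and comparison with the index\<close>

lemma setting_arr [simp]:
  assumes "X \<in> Obj C"
  shows "dop (setting_of X) \<in> Arr D" "Dom D (dop (setting_of X)) = prd D (FO U X) (FO U X)"
    "Cod D (dop (setting_of X)) = FO U X"
    "pnt (setting_of X) \<in> Arr D" "Dom D (pnt (setting_of X)) = one D" "Cod D (pnt (setting_of X)) = FO U X"
  using D.hyper_slominskiD[OF setting_of(1)[OF assms]] setting_of(2)[OF assms] by simp_all

lemma dop_setting_of:
  assumes X: "X \<in> Obj C" and w: "w \<in> hom D T (FO U (prd C X X))"
  shows "dop (setting_of X) \<cdot>\<^bsub>D\<^esub> tuple D (FA U (sq1 X) \<cdot>\<^bsub>D\<^esub> w) (FA U (sq2 X) \<cdot>\<^bsub>D\<^esub> w) = diff X \<cdot>\<^bsub>D\<^esub> w"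
  unfolding setting_of(3)[OF X, symmetric] using X w by (simp add: hom_def)

text \<open>Naturality of \<open>gamma\<close> along \<open>(h x h, h)\<close> passes to
  \<open>diff\<close>, because the induced map \<open>g\<close> of kernels becomes \<open>h\<close>
  once the kernels are identified with the objects. The result is then moved from
  \<open>U (X x X)\<close> to the chosen product.\<close>

lemma lift_preserves_dop:
  assumes h: "h \<in> Arr C"
  shows "FA U h \<cdot>\<^bsub>D\<^esub> dop (setting_of (Dom C h))
    = dop (setting_of (Cod C h)) \<cdot>\<^bsub>D\<^esub> prod_arr D (FA U h) (FA U h)"
proof -
  let ?X = "Dom C h" and ?Y = "Cod C h"
  let ?hh = "prod_arr C h h" and ?A = "FO U (Dom C h)"
  note [simp] = h
  obtain g where g: "g \<in> hom C (Ker (sq2 ?X)) (Ker (sq2 ?Y))"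
    "ker C (sq2 ?Y) \<cdot>\<^bsub>C\<^esub> g = ?hh \<cdot>\<^bsub>C\<^esub> ker C (sq2 ?X)"
    "gamma (sq2 ?Y) (diag ?Y) \<cdot>\<^bsub>D\<^esub> FA U ?hh = FA U g \<cdot>\<^bsub>D\<^esub> gamma (sq2 ?X) (diag ?X)"
    by (rule gamma_natural[of "sq2 ?X" "diag ?X" "sq2 ?Y" "diag ?Y" ?hh h])
      (simp_all add: diag_split_epi hom_def, simp add: prod_arr_def)
  have [simp]: "g \<in> Arr C" "Dom C g = Ker (sq2 ?X)" "Cod C g = Ker (sq2 ?Y)"
    using g(1) by (auto simp: hom_def)
  note [simp] = gamma_arr[OF diag_split_epi[of ?X]] gamma_arr[OF diag_split_epi[of ?Y]]
  have sq: "sq1 ?Y \<cdot>\<^bsub>C\<^esub> ?hh = h \<cdot>\<^bsub>C\<^esub> sq1 ?X" "sq2 ?Y \<cdot>\<^bsub>C\<^esub> ?hh = h \<cdot>\<^bsub>C\<^esub> sq2 ?X"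
    by (simp_all add: prod_arr_def)
  have "(sq1 ?Y \<cdot>\<^bsub>C\<^esub> ker C (sq2 ?Y)) \<cdot>\<^bsub>C\<^esub> g = sq1 ?Y \<cdot>\<^bsub>C\<^esub> (?hh \<cdot>\<^bsub>C\<^esub> ker C (sq2 ?X))"
    by (simp add: g(2))
  also have "\<dots> = (sq1 ?Y \<cdot>\<^bsub>C\<^esub> ?hh) \<cdot>\<^bsub>C\<^esub> ker C (sq2 ?X)" by simp
  also have "\<dots> = h \<cdot>\<^bsub>C\<^esub> (sq1 ?X \<cdot>\<^bsub>C\<^esub> ker C (sq2 ?X))" unfolding sq by simp
  finally have e: "FA U (sq1 ?Y \<cdot>\<^bsub>C\<^esub> ker C (sq2 ?Y)) \<cdot>\<^bsub>D\<^esub> FA U g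
      = FA U h \<cdot>\<^bsub>D\<^esub> FA U (sq1 ?X \<cdot>\<^bsub>C\<^esub> ker C (sq2 ?X))"
    by (simp flip: functor_simps(6) del: functor_simps(6) C.comp_assoc)
  have "diff ?Y \<cdot>\<^bsub>D\<^esub> FA U ?hh = FA U (sq1 ?Y \<cdot>\<^bsub>C\<^esub> ker C (sq2 ?Y)) \<cdot>\<^bsub>D\<^esub>
      (gamma (sq2 ?Y) (diag ?Y) \<cdot>\<^bsub>D\<^esub> FA U ?hh)"
    by (simp add: diff_def del: functor_simps(6))
  also have "\<dots> = (FA U (sq1 ?Y \<cdot>\<^bsub>C\<^esub> ker C (sq2 ?Y)) \<cdot>\<^bsub>D\<^esub> FA U g) \<cdot>\<^bsub>D\<^esub> gamma (sq2 ?X) (diag ?X)"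
    unfolding g(3) by (simp del: functor_simps(6))
  also have "\<dots> = FA U h \<cdot>\<^bsub>D\<^esub> diff ?X"
    unfolding e by (simp add: diff_def del: functor_simps(6))
  finally have diff: "diff ?Y \<cdot>\<^bsub>D\<^esub> FA U ?hh = FA U h \<cdot>\<^bsub>D\<^esub> diff ?X" .
  \<comment> \<open>\<open>w\<close> is the inverse of the comparison from \<open>U (X x X)\<close>
    to the chosen product.\<close>
  have "\<exists>!w. w \<in> hom D (prd D ?A ?A) (FO U (prd C ?X ?X)) \<and>
      FA U (sq1 ?X) \<cdot>\<^bsub>D\<^esub> w = pr1 D ?A ?A \<and> FA U (sq2 ?X) \<cdot>\<^bsub>D\<^esub> w = pr2 D ?A ?A"
    by (rule D.product_ex1[OF product_image[OF C.product]]) (simp_all add: hom_def)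
  then obtain w where w: "w \<in> hom D (prd D ?A ?A) (FO U (prd C ?X ?X))"
    "FA U (sq1 ?X) \<cdot>\<^bsub>D\<^esub> w = pr1 D ?A ?A" "FA U (sq2 ?X) \<cdot>\<^bsub>D\<^esub> w = pr2 D ?A ?A"
    by (blast dest: ex1_implies_ex)
  have [simp]: "w \<in> Arr D" "Dom D w = prd D ?A ?A" "Cod D w = FO U (prd C ?X ?X)"
    using w(1) by (auto simp: hom_def)
  have pr: "tuple D (pr1 D ?A ?A) (pr2 D ?A ?A) = Idt D (prd D ?A ?A)"
    using D.tuple_eta[of "Idt D (prd D ?A ?A)" "prd D ?A ?A" ?A ?A] by (simp add: hom_def)
  have "FA U (sq1 ?Y) \<cdot>\<^bsub>D\<^esub> (FA U ?hh \<cdot>\<^bsub>D\<^esub> w) = FA U (sq1 ?Y \<cdot>\<^bsub>C\<^esub> ?hh) \<cdot>\<^bsub>D\<^esub> w"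
    "FA U (sq2 ?Y) \<cdot>\<^bsub>D\<^esub> (FA U ?hh \<cdot>\<^bsub>D\<^esub> w) = FA U (sq2 ?Y \<cdot>\<^bsub>C\<^esub> ?hh) \<cdot>\<^bsub>D\<^esub> w"
    by simp_all
  then have sqw: "FA U (sq1 ?Y) \<cdot>\<^bsub>D\<^esub> (FA U ?hh \<cdot>\<^bsub>D\<^esub> w) = FA U h \<cdot>\<^bsub>D\<^esub> pr1 D ?A ?A"
    "FA U (sq2 ?Y) \<cdot>\<^bsub>D\<^esub> (FA U ?hh \<cdot>\<^bsub>D\<^esub> w) = FA U h \<cdot>\<^bsub>D\<^esub> pr2 D ?A ?A"
    unfolding sq by (simp_all add: w)
  have "FA U h \<cdot>\<^bsub>D\<^esub> dop (setting_of ?X) = FA U h \<cdot>\<^bsub>D\<^esub> (diff ?X \<cdot>\<^bsub>D\<^esub> w)"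
    using dop_setting_of[OF _ w(1)] by (simp add: w pr)
  also have "\<dots> = (diff ?Y \<cdot>\<^bsub>D\<^esub> FA U ?hh) \<cdot>\<^bsub>D\<^esub> w" unfolding diff by simp
  also have "\<dots> = diff ?Y \<cdot>\<^bsub>D\<^esub> (FA U ?hh \<cdot>\<^bsub>D\<^esub> w)" by simp
  also have "\<dots> = dop (setting_of ?Y) \<cdot>\<^bsub>D\<^esub> prod_arr D (FA U h) (FA U h)"
    using dop_setting_of[of ?Y "FA U ?hh \<cdot>\<^bsub>D\<^esub> w" "prd D ?A ?A"]
    unfolding sqw by (simp add: prod_arr_def[of D] hom_def)
  finally show ?thesis .
qed

text \<open>This is the equation that defines \<open>canonical_gamma\<close>; it comes from
  naturality along \<open>(<Id, sf>, s)\<close> into the diagonal point.\<close>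

lemma ker_gamma:
  assumes fs: "(f, s) \<in> split_epis C"
  shows "FA U (ker C f) \<cdot>\<^bsub>D\<^esub> gamma f s = dop (setting_of (Dom C f)) \<cdot>\<^bsub>D\<^esub>
    tuple D (Idt D (FO U (Dom C f))) (FA U s \<cdot>\<^bsub>D\<^esub> FA U f)"
proof -
  note [simp] = split_epiD[OF fs] gamma_arr[OF fs]
  let ?X = "Dom C f"
  note [simp] = gamma_arr[OF diag_split_epi[of ?X]]
  let ?x = "tuple C (Idt C ?X) (s \<cdot>\<^bsub>C\<^esub> f)"
  obtain g where g: "g \<in> hom C (Ker f) (Ker (sq2 ?X))"
    "ker C (sq2 ?X) \<cdot>\<^bsub>C\<^esub> g = ?x \<cdot>\<^bsub>C\<^esub> ker C f"
    "gamma (sq2 ?X) (diag ?X) \<cdot>\<^bsub>D\<^esub> FA U ?x = FA U g \<cdot>\<^bsub>D\<^esub> gamma f s"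
    by (rule gamma_natural[OF fs diag_split_epi[of ?X], of ?x s]) (simp_all add: hom_def)
  have [simp]: "g \<in> Arr C" "Dom C g = Ker f" "Cod C g = Ker (sq2 ?X)"
    using g(1) by (auto simp: hom_def)
  \<comment> \<open>The first coordinate of \<open>?x\<close> is the identity, so \<open>g\<close>
    is the kernel inclusion of \<open>f\<close> once the kernel of \<open>sq2\<close> is identified
    with \<open>?X\<close>.\<close>
  have "(sq1 ?X \<cdot>\<^bsub>C\<^esub> ker C (sq2 ?X)) \<cdot>\<^bsub>C\<^esub> g = ker C f"
    by (simp add: g(2))
  then have e: "FA U (sq1 ?X \<cdot>\<^bsub>C\<^esub> ker C (sq2 ?X)) \<cdot>\<^bsub>D\<^esub> FA U g = FA U (ker C f)"
    by (simp flip: functor_simps(6) del: functor_simps(6) C.comp_assoc)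
  have sqx: "FA U (sq1 ?X) \<cdot>\<^bsub>D\<^esub> FA U ?x = Idt D (FO U ?X)"
    "FA U (sq2 ?X) \<cdot>\<^bsub>D\<^esub> FA U ?x = FA U s \<cdot>\<^bsub>D\<^esub> FA U f"
    by (simp_all flip: functor_simps(6))
  have "dop (setting_of ?X) \<cdot>\<^bsub>D\<^esub> tuple D (Idt D (FO U ?X)) (FA U s \<cdot>\<^bsub>D\<^esub> FA U f)
      = diff ?X \<cdot>\<^bsub>D\<^esub> FA U ?x"
    using dop_setting_of[of ?X "FA U ?x" "FO U ?X"] unfolding sqx by (simp add: hom_def)
  also have "\<dots> = FA U (sq1 ?X \<cdot>\<^bsub>C\<^esub> ker C (sq2 ?X)) \<cdot>\<^bsub>D\<^esub> (gamma (sq2 ?X) (diag ?X) \<cdot>\<^bsub>D\<^esub> FA U ?x)"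
    by (simp add: diff_def del: functor_simps(6))
  also have "\<dots> = (FA U (sq1 ?X \<cdot>\<^bsub>C\<^esub> ker C (sq2 ?X)) \<cdot>\<^bsub>D\<^esub> FA U g) \<cdot>\<^bsub>D\<^esub> gamma f s"
    unfolding g(3) by (simp del: functor_simps(6))
  finally show ?thesis unfolding e ..
qed

text \<open>\<open>lift\<close> itself does not depend on \<open>P\<close>, so one argument covers
  both categories of settings.\<close>

lemma index_factorization_lift:
  assumes P: "settings_category D P" and P_setting: "\<And>X. X \<in> Obj C \<Longrightarrow> P (setting_of X)"
  shows "index_factorization C D U \<rho> (settings D P) lift"
  unfolding index_factorization_def
proof (intro conjI)
  interpret P: settings_category D P by (rule P)
  note [simp] = setting_of(2) P_setting
  have lift_arr: "FA lift f \<in> Arr (settings D P)" if "f \<in> Arr C" for f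
    using that lift_preserves_dop[OF that] by (simp add: lift_def P.settings_arr hom_def)
  then show "is_functor C (settings D P) lift"
    using C.category_axioms P.category_settings
    by (auto simp: is_functor_def hom_def lift_def)
  show "functor_eq C U (functor_comp forgetful lift)"
    by (simp add: functor_eq_def functor_comp_def forgetful_def lift_def)
  have "is_kernel (settings D P) (FA lift f) (FA lift (ker C f)) \<and>
      \<rho> (f, s) = canonical_index D (FA lift f, FA lift s) (FA lift (ker C f))"
    if fs: "(f, s) \<in> split_epis C" for f s
  proof
    note [simp] = split_epiD[OF fs] gamma_arr[OF fs]
    \<comment> \<open>Kernels are carried over in two stages: \<open>U\<close> preserves them, and
      \<open>kernel_settings\<close> then lifts them to settings.\<close>
    have ker: "is_kernel D (FA U f) (FA U (ker C f))"
      by (simp add: kernel_image C.kernel)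
    show "is_kernel (settings D P) (FA lift f) (FA lift (ker C f))"
      using P.kernel_settings[OF _ _ ker] lift_arr[of f] lift_arr[of "ker C f"] by (simp add: lift_def)
    \<comment> \<open>\<open>canonical_gamma\<close> is a description: \<open>ker_gamma\<close>
      shows that \<open>gamma\<close> satisfies it, and uniqueness holds since the kernel is
      monic.\<close>
    have "canonical_gamma D (FA lift f) (FA lift s) (FA lift (ker C f)) = gamma f s"
      unfolding canonical_gamma_def lift_def
    proof (simp add: flip: ker_gamma[OF fs], rule the_equality)
      show "gamma f s \<in> hom D (FO U (Dom C f)) (FO U (Ker f)) \<and>
        FA U (ker C f) \<cdot>\<^bsub>D\<^esub> gamma f s = FA U (ker C f) \<cdot>\<^bsub>D\<^esub> gamma f s"
        by (simp add: hom_def)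
    qed (rule D.kernel_mono[OF ker], simp_all add: hom_def)
    moreover have "tuple D (FA U f) (gamma f s) = index_top f s"
      using D.tuple_eta[OF index_component(2)[OF fs]]
      by (simp add: index_component(3)[OF fs] index_gamma_def)
    ultimately show "\<rho> (f, s) = canonical_index D (FA lift f, FA lift s) (FA lift (ker C f))"
      \<comment> \<open>One \<open>subst\<close> only, as the right side of the component formula
        contains \<rho> again.\<close>
      by (subst index_component(1)[OF fs]) (simp add: canonical_index_def lift_def W_obj_def)
  qed
  then show "\<forall>(f, s) \<in> split_epis C. is_kernel (settings D P) (FA lift f) (FA lift (ker C f)) \<and>
      \<rho> (f, s) = canonical_index D (FA lift f, FA lift s) (FA lift (ker C f))"
    by blast
qed

text \<open>The pair \<open>(x, 1)\<close> lies in the kernel of the second projection. There the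
  hyperindex condition makes \<open>gamma\<close> the identity, and the first coordinate of the pair
  is \<open>x\<close>.\<close>

lemma hypersubtraction_setting_of:
  assumes hyper: "semi_direct_hyperindex C D U \<rho>" and X: "X \<in> Obj C"
  shows "hypersubtraction D (setting_of X)"
  unfolding hypersubtraction_def
proof (intro conjI ballI)
  note [simp] = X gamma_arr[OF diag_split_epi[OF X]] setting_of(2)[OF X]
  show "hyper_slominski D (setting_of X)" by (simp add: setting_of)
  fix T x assume T: "T \<in> Obj D" and x: "x \<in> hom D T (car (setting_of X))"
  then have [simp]: "x \<in> Arr D" "Dom D x = T" "Cod D x = FO U X"
    by (auto simp: hom_def)
  let ?k = "ker C (sq2 X)"
  obtain j where j: "j \<in> hom C X (Ker (sq2 X))" and kj: "?k \<cdot>\<^bsub>C\<^esub> j = tuple C (Idt C X) (zero_arr C X X)"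
    and ej: "(sq1 X \<cdot>\<^bsub>C\<^esub> ?k) \<cdot>\<^bsub>C\<^esub> j = Idt C X"
    using ker_sq2[OF X] by metis
  have [simp]: "j \<in> Arr C" "Dom C j = X" "Cod C j = Ker (sq2 X)"
    using j by (auto simp: hom_def)
  have \<gamma>k: "gamma (sq2 X) (diag X) \<cdot>\<^bsub>D\<^esub> FA U ?k = Idt D (FO U (Ker (sq2 X)))"
    using hyper diag_split_epi[OF X] unfolding semi_direct_hyperindex_def by blast
  \<comment> \<open>\<open>?w\<close> is the pair \<open>(x, 1)\<close> as an element of
    \<open>U (X x X)\<close>.\<close>
  let ?w = "FA U (?k \<cdot>\<^bsub>C\<^esub> j) \<cdot>\<^bsub>D\<^esub> x"
  have "FA U (sq1 X \<cdot>\<^bsub>C\<^esub> (?k \<cdot>\<^bsub>C\<^esub> j)) = Idt D (FO U X)"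
    "FA U (sq2 X \<cdot>\<^bsub>C\<^esub> (?k \<cdot>\<^bsub>C\<^esub> j)) = zero_arr D (FO U X) (FO U X)"
    unfolding kj by (simp_all del: functor_simps(6))
  then have w1: "FA U (sq1 X \<cdot>\<^bsub>C\<^esub> (?k \<cdot>\<^bsub>C\<^esub> j)) \<cdot>\<^bsub>D\<^esub> x = x"
    and w2: "FA U (sq2 X \<cdot>\<^bsub>C\<^esub> (?k \<cdot>\<^bsub>C\<^esub> j)) \<cdot>\<^bsub>D\<^esub> x = zero_arr D T (FO U X)"
    by (simp_all del: functor_simps(6) C.comp_assoc)
  have w: "FA U (sq1 X) \<cdot>\<^bsub>D\<^esub> ?w = x" "FA U (sq2 X) \<cdot>\<^bsub>D\<^esub> ?w = zero_arr D T (FO U X)"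
    by (subst w1[symmetric], simp) (subst w2[symmetric], simp)
  have "pnt (setting_of X) \<cdot>\<^bsub>D\<^esub> to_one D T = zero_arr D T (FO U X)"
    by (rule D.zero_arr_via_one[symmetric]) (simp_all add: hom_def T)
  then have "dop (setting_of X) \<cdot>\<^bsub>D\<^esub> tuple D x (pnt (setting_of X) \<cdot>\<^bsub>D\<^esub> to_one D T) = diff X \<cdot>\<^bsub>D\<^esub> ?w"
    using dop_setting_of[OF X, of ?w T] unfolding w by (simp add: hom_def)
  also have "\<dots> = FA U (sq1 X \<cdot>\<^bsub>C\<^esub> ?k) \<cdot>\<^bsub>D\<^esub>
      ((gamma (sq2 X) (diag X) \<cdot>\<^bsub>D\<^esub> FA U ?k) \<cdot>\<^bsub>D\<^esub> (FA U j \<cdot>\<^bsub>D\<^esub> x))"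
    by (simp add: diff_def)
  also have "\<dots> = FA U ((sq1 X \<cdot>\<^bsub>C\<^esub> ?k) \<cdot>\<^bsub>C\<^esub> j) \<cdot>\<^bsub>D\<^esub> x"
    unfolding \<gamma>k by simp
  also have "\<dots> = x" unfolding ej by simp
  finally show "dop (setting_of X) \<cdot>\<^bsub>D\<^esub> tuple D x (pnt (setting_of X) \<cdot>\<^bsub>D\<^esub> to_one D T) = x" .
qed

end

theorem theorem3p1:
  fixes C :: "('o, 'a) chosen_category"
    and D :: "('p, 'b) chosen_category"
    and U :: "('o, 'a, 'p, 'b) cat_functor"
    and \<rho> :: "'a pt_obj \<Rightarrow> 'b pt_arr"
  assumes "finitely_complete_pointed C"
    and "finitely_complete_pointed D"
    and "left_exact C D U"
    and "semi_direct_index C D U \<rho>"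
  shows "(\<exists>V. index_factorization C D U \<rho> (Slom D) V) \<and>
         (semi_direct_hyperindex C D U \<rho> \<longrightarrow>
            (\<exists>V. index_factorization C D U \<rho> (HSt D) V))"
proof -
  interpret indexed_functor C D U \<rho>
    by unfold_locales (rule assms)+
  \<comment> \<open>Both claims use the same functor \<open>lift\<close>; in the hyperindex case its
    values are hypersubtractions.\<close>
  have "settings_category D (hyper_slominski D)" "settings_category D (hypersubtraction D)"
    using D.hypersubtraction_trivial D.hypersubtraction_imp by unfold_locales auto
  then show ?thesis
    unfolding Slom_def HSt_def
    using index_factorization_lift setting_of(1) hypersubtraction_setting_of by blast
qed

end
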